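(* Let $k\geq2$ and $\alpha\geq2$ be integers. The decision problem "Given a $k$-regular sequence $(f(n))_{n\geq0}$, does $(f(n))_{n\geq0}$ contain an $\alpha$-power?" is recursively unsolvable.
   Context: For $n\in\mathbb{N}_0$, $(n)_k=n_{s-1}\cdots n_0$ is the standard base-$k$ representation of $n$ (no leading zeros; $(0)_k$ empty). A sequence $(f(n))_{n\geq0}$ is $k$-regular if there exist $r\geq0$, a $1\times r$ row vector $v$, an $r\times1$ column vector $w$ and $r\times r$ matrices $M_0,\dots,M_{k-1}$ such that $f(n)=vM_{n_0}\cdots M_{n_{s-1}}w$ for all $n$; the input is such a linear representation. An $\alpha$-power in $(f(n))$ is a nonempty contiguous block $(f(j))_{i\leq j<i+\alpha m}$, for some $i\geq0$ and $m\geq1$, such that $f(i+t)=f(i+sm+t)$ for all $0\leq s<\alpha$ and $0\leq t<m$. *)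

theory Defs
  imports Main "HOL-Library.Nat_Bijection"
begin

fun digits :: "nat \<Rightarrow> nat \<Rightarrow> nat list" where
  "digits k n = (if n = 0 \<or> k < 2 then [] else n mod k # digits k (n div k))"

text \<open>A linear representation of dimension r: row vector v, column vector w
  (both lists of length r), and matrices M_0..M_(k-1) (lists of r rows of length r),
  all with integer entries.\<close>
type_synonym linrep = "int list \<times> int list \<times> int list list list"

definition wf_linrep :: "nat \<Rightarrow> linrep \<Rightarrow> bool" where
  "wf_linrep k R = (case R of (v, w, Ms) \<Rightarrow>
     length w = length v \<and> length Ms = k \<and>
     (\<forall>M \<in> set Ms. length M = length v \<and> (\<forall>row \<in> set M. length row = length v)))"

definition vecmat :: "nat \<Rightarrow> int list \<Rightarrow> int list list \<Rightarrow> int list" where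
  "vecmat r u M = map (\<lambda>j. \<Sum>i<r. u ! i * (M ! i) ! j) [0..<r]"

definition dotp :: "nat \<Rightarrow> int list \<Rightarrow> int list \<Rightarrow> int" where
  "dotp r u w = (\<Sum>i<r. u ! i * w ! i)"

definition linrep_seq :: "nat \<Rightarrow> linrep \<Rightarrow> nat \<Rightarrow> int" where
  "linrep_seq k R n = (case R of (v, w, Ms) \<Rightarrow>
     dotp (length v) (foldl (\<lambda>u d. vecmat (length v) u (Ms ! d)) v (digits k n)) w)"

definition has_power :: "(nat \<Rightarrow> int) \<Rightarrow> nat \<Rightarrow> bool" where
  "has_power f \<alpha> = (\<exists>i m. m \<ge> 1 \<and> (\<forall>s<\<alpha>. \<forall>t<m. f (i + t) = f (i + s * m + t)))"

definition enc_intlist :: "int list \<Rightarrow> nat" where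
  "enc_intlist xs = list_encode (map int_encode xs)"

definition enc_mat :: "int list list \<Rightarrow> nat" where
  "enc_mat M = list_encode (map enc_intlist M)"

definition enc_linrep :: "linrep \<Rightarrow> nat" where
  "enc_linrep R = (case R of (v, w, Ms) \<Rightarrow>
     prod_encode (enc_intlist v, prod_encode (enc_intlist w, list_encode (map enc_mat Ms))))"

datatype recf = Zf | Sf | Proj nat | Comp recf "recf list" | Prec recf recf | Mn recf

inductive reval :: "recf \<Rightarrow> nat list \<Rightarrow> nat \<Rightarrow> bool" where
  zero: "reval Zf xs 0"
| succ: "reval Sf (x # xs) (Suc x)"
| proj: "i < length xs \<Longrightarrow> reval (Proj i) xs (xs ! i)"
| comp: "list_all2 (\<lambda>g y. reval g xs y) gs ys \<Longrightarrow> reval f ys z \<Longrightarrow> reval (Comp f gs) xs z"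
| prec0: "reval f xs y \<Longrightarrow> reval (Prec f g) (0 # xs) y"
| precS: "reval (Prec f g) (n # xs) y \<Longrightarrow> reval g (n # y # xs) z \<Longrightarrow>
           reval (Prec f g) (Suc n # xs) z"
| mn: "reval f (n # xs) 0 \<Longrightarrow> (\<forall>m<n. \<exists>y. y > 0 \<and> reval f (m # xs) y) \<Longrightarrow>
           reval (Mn f) xs n"

definition recursive_set :: "nat set \<Rightarrow> bool" where
  "recursive_set A = (\<exists>p. \<forall>n. reval p [n] (if n \<in> A then 1 else 0))"

text \<open>The decision problem: codes of k-regular sequences (given by linear
  representations) containing an alpha-power.\<close>
definition power_problem :: "nat \<Rightarrow> nat \<Rightarrow> nat set" where
  "power_problem k \<alpha> = {enc_linrep R | R. wf_linrep k R \<and> has_power (linrep_seq k R) \<alpha>}"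

end

theory Submission
  imports Defs HOL.Modules "HOL-Library.Function_Algebras"
begin

text \<open>
  Every partial recursive function is computed by a nondeterministic program over finitely many
  registers that only uses affine assignments and equality tests. Its runs are encoded by digit
  strings, each digit selecting a branch of the flowchart. Since the sum of the squared errors of
  the tests is a polynomial in the registers, it is a regular sequence $a$ of the digit string, and
  the program accepts iff $a$ has a zero. The sequence $(a(N+1))^2 + aN$, with $a$ taken at $N$
  without its lowest digits, is injective if $a$ has no zero, and otherwise contains $\<alpha>$
  consecutive zeros; so it has an $\<alpha>$-power iff the program accepts.

  The input of the program enters only through the row vector, which consists of monomials in the
  input followed by zeros. Hence the code of the instance for a fixed program is a computable
  function of the input, uniformly in two constants that describe the program. Feeding a program
  with its own two constants diagonalises against any decision procedure without a universal machine.
\<close>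

section \<open>Recursive functions\<close>

inductive_cases reval_Zf: "reval Zf xs y"
inductive_cases reval_Sf: "reval Sf xs y"
inductive_cases reval_Proj: "reval (Proj i) xs y"
inductive_cases reval_Comp: "reval (Comp f gs) xs y"
inductive_cases reval_Prec: "reval (Prec f g) xs y"
inductive_cases reval_Prec0: "reval (Prec f g) (0 # xs) y"
inductive_cases reval_PrecS: "reval (Prec f g) (Suc n # xs) y"
inductive_cases reval_Mn: "reval (Mn f) xs y"

text \<open>Values are unique, so a computed answer 1 excludes the answer 0; for \<open>Mn\<close>,
  the smaller of two candidate minima would have both a zero and a positive value.\<close>

lemma reval_det: "reval p xs y \<Longrightarrow> reval p xs z \<Longrightarrow> y = z"
proof (induction arbitrary: z rule: reval.induct)
  case (comp xs gs ys f y)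
  from comp.prems obtain ys' where ys': "list_all2 (\<lambda>g y. reval g xs y) gs ys'" "reval f ys' z"
    by (rule reval_Comp)
  with comp.IH(1) have "ys = ys'"
    by (auto simp: list_all2_conv_all_nth intro!: nth_equalityI)
  then show ?case using ys' comp.IH(2) by simp
next
  case (mn f n xs)
  from mn.prems have z: "reval f (z # xs) 0" "\<forall>m<z. \<exists>y>0. reval f (m # xs) y"
    by (auto elim: reval_Mn)
  show ?case
  proof (rule linorder_cases[of n z])
    assume "n < z"
    with z mn.IH(1) show ?thesis by fastforce
  next
    assume "z < n"
    with z mn.IH(2) show ?thesis by fastforce
  qed
next
  case (prec0 f xs y g)
  then show ?case by (metis reval_Prec0)
next
  case (precS f g n xs y w)
  then show ?case by (metis reval_PrecS)
qed (auto elim: reval_Zf reval_Sf reval_Proj)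

section \<open>Total recursive functions of two arguments\<close>

definition computable2 :: "(nat \<Rightarrow> nat \<Rightarrow> nat) \<Rightarrow> bool" where
  "computable2 f \<longleftrightarrow> (\<exists>p. \<forall>x y. reval p [x, y] (f x y))"

lemma reval_CompI1: "reval g xs y \<Longrightarrow> reval f [y] z \<Longrightarrow> reval (Comp f [g]) xs z"
  by (rule reval.comp[of _ _ "[y]"]) auto

lemma reval_CompI2:
  "reval g xs y \<Longrightarrow> reval h xs y' \<Longrightarrow> reval f [y, y'] z \<Longrightarrow> reval (Comp f [g, h]) xs z"
  by (rule reval.comp[of _ _ "[y, y']"]) auto

lemma reval_ProjI: "i < length xs \<Longrightarrow> y = xs ! i \<Longrightarrow> reval (Proj i) xs y"
  by (simp add: reval.proj)

lemma computable2_fst: "computable2 (\<lambda>x y. x)"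
  unfolding computable2_def by (rule exI[of _ "Proj 0"]) (auto intro: reval_ProjI)

lemma computable2_snd: "computable2 (\<lambda>x y. y)"
  unfolding computable2_def by (rule exI[of _ "Proj 1"]) (auto intro: reval_ProjI)

lemma computable2_0: "computable2 (\<lambda>x y. 0)"
  unfolding computable2_def by (blast intro: reval.zero)

lemma computable2_Suc:
  assumes "computable2 f"
  shows "computable2 (\<lambda>x y. Suc (f x y))"
proof -
  obtain p where "\<And>x y. reval p [x, y] (f x y)"
    using assms unfolding computable2_def by blast
  then have "reval (Comp Sf [p]) [x, y] (Suc (f x y))" for x y
    using reval_CompI1 reval.succ by metis
  then show ?thesis unfolding computable2_def by blast
qed

lemma computable2_comp:
  assumes "computable2 h" "computable2 f" "computable2 g"
  shows "computable2 (\<lambda>x y. h (f x y) (g x y))"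
proof -
  obtain p q r where "\<And>x y. reval p [x, y] (h x y)" "\<And>x y. reval q [x, y] (f x y)"
    "\<And>x y. reval r [x, y] (g x y)"
    using assms unfolding computable2_def by metis
  then have "reval (Comp p [q, r]) [x, y] (h (f x y) (g x y))" for x y
    using reval_CompI2 by metis
  then show ?thesis unfolding computable2_def by blast
qed

lemma reval_PrecI:
  assumes "reval f xs (h 0)" "\<And>n. reval g (n # h n # xs) (h (Suc n))"
  shows "reval (Prec f g) (n # xs) (h n)"
  by (induction n) (auto intro: reval.prec0 reval.precS assms)

lemma computable2_add: "computable2 (+)"
  unfolding computable2_def
proof (intro exI allI)
  fix x y
  show "reval (Prec (Proj 0) (Comp Sf [Proj 1])) [x, y] (x + y)"
    by (rule reval_PrecI[where h = "\<lambda>x. x + y"])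
      (auto intro!: reval_ProjI reval_CompI1 reval.succ)
qed

lemma computable2_mult: "computable2 (*)"
  unfolding computable2_def
proof -
  obtain p where p: "\<And>x y. reval p [x, y] (x + y)"
    using computable2_add unfolding computable2_def by blast
  have "reval (Prec Zf (Comp p [Proj 2, Proj 1])) [x, y] (x * y)" for x y
    by (rule reval_PrecI[where h = "\<lambda>x. x * y"])
      (auto intro!: reval_CompI2 p reval_ProjI reval.zero)
  then show "\<exists>p. \<forall>x y. reval p [x, y] (x * y)" by blast
qed

lemma computable2_triangle: "computable2 (\<lambda>x y. triangle x)"
  unfolding computable2_def
proof -
  obtain p where p: "\<And>x y. reval p [x, y] (x + y)"
    using computable2_add unfolding computable2_def by blast
  have "reval (Prec Zf (Comp p [Proj 1, Comp Sf [Proj 0]])) [x, y] (triangle x)" for x y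
    by (rule reval_PrecI[where h = triangle])
      (auto intro!: reval_CompI2 reval_CompI1 reval.succ p[of "triangle n" "Suc n" for n, simplified] reval_ProjI reval.zero)
  then show "\<exists>p. \<forall>x y. reval p [x, y] (triangle x)" by blast
qed

lemma computable2_prod_encode: "computable2 (\<lambda>x y. prod_encode (x, y))"
  unfolding prod_encode_def prod.case
  by (intro computable2_comp[OF computable2_add] computable2_fst
      computable2_comp[OF computable2_triangle _ computable2_0] computable2_snd)

lemma computable2_power: "computable2 f \<Longrightarrow> computable2 (\<lambda>x y. f x y ^ i)"
proof (induction i)
  case 0
  show ?case using computable2_Suc[OF computable2_0] by simp
next
  case (Suc i)
  then show ?case using computable2_comp[OF computable2_mult] by simp
qed

section \<open>Nondeterministic affine register programs\<close>

text \<open>There is no conditional jump: a \<open>Test\<close> is an assertion, and a failing one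
  blocks the run. All choice comes from the unbounded iteration \<open>Star\<close>, so programs
  guess and then check.\<close>

datatype instr = Asg nat nat nat nat | Test nat nat

datatype prog = Instr instr | Seq prog prog | Star prog

fun exec :: "instr \<Rightarrow> (nat \<Rightarrow> nat) \<Rightarrow> nat \<Rightarrow> nat" where
  "exec (Asg i b j c) s = s(i := b * s j + c)"
| "exec (Test i j) s = s"

text \<open>Squares cannot cancel, so a sum of defects along a run vanishes only if every single
  test succeeds, and each summand stays polynomial in the registers.\<close>

fun defect :: "instr \<Rightarrow> (nat \<Rightarrow> nat) \<Rightarrow> int" where
  "defect (Asg i b j c) s = 0"
| "defect (Test i j) s = (int (s i) - int (s j))\<^sup>2"

fun sem :: "prog \<Rightarrow> ((nat \<Rightarrow> nat) \<times> (nat \<Rightarrow> nat)) set" where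
  "sem (Instr a) = {(s, exec a s) |s. defect a s = 0}"
| "sem (Seq P Q) = sem P O sem Q"
| "sem (Star P) = (sem P)\<^sup>*"

lemma sem_Asg [simp]: "(s, t) \<in> sem (Instr (Asg i b j c)) \<longleftrightarrow> t = s(i := b * s j + c)"
  by auto

lemma sem_Test [simp]: "(s, t) \<in> sem (Instr (Test i j)) \<longleftrightarrow> t = s \<and> s i = s j"
  by auto

lemma sem_Seq [simp]: "(s, t) \<in> sem (Seq P Q) \<longleftrightarrow> (\<exists>u. (s, u) \<in> sem P \<and> (u, t) \<in> sem Q)"
  by auto

declare sem.simps(1,2) [simp del]

lemma sem_SeqI: "(s, u) \<in> sem P \<Longrightarrow> (u, t) \<in> sem Q \<Longrightarrow> (s, t) \<in> sem (Seq P Q)"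
  by auto

lemma sem_Seq_Star:
  "(s, u) \<in> sem (Seq P (Star Q)) \<Longrightarrow> (u, t) \<in> sem Q \<Longrightarrow> (s, t) \<in> sem (Seq P (Star Q))"
  by (auto intro: rtrancl_into_rtrancl)

text \<open>Every run that gets through is correct, and every value is reached by some run;
  divergence means that no run gets through. Registers from \<open>b\<close> on are scratch space,
  all others except \<open>r\<close> are preserved.\<close>

definition implements :: "prog \<Rightarrow> recf \<Rightarrow> nat list \<Rightarrow> nat \<Rightarrow> nat \<Rightarrow> bool" where
  "implements P q as r b \<longleftrightarrow>
     (\<forall>s t. (s, t) \<in> sem P \<longrightarrow> reval q (map s as) (t r) \<and> (\<forall>i<b. i \<noteq> r \<longrightarrow> t i = s i)) \<and>
     (\<forall>s y. reval q (map s as) y \<longrightarrow> (\<exists>t. (s, t) \<in> sem P \<and> t r = y))"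

definition implementable :: "recf \<Rightarrow> bool" where
  "implementable q \<longleftrightarrow> (\<forall>as r b. (\<forall>a \<in> set as. a < b) \<longrightarrow> r < b \<longrightarrow> (\<exists>P. implements P q as r b))"

lemma implementsD:
  assumes "implements P q as r b" "(s, t) \<in> sem P"
  shows "reval q (map s as) (t r)" "i < b \<Longrightarrow> i \<noteq> r \<Longrightarrow> t i = s i"
  using assms unfolding implements_def by blast+

lemma implements_run:
  assumes "implements P q as r b" "reval q (map s as) y"
  obtains t where "(s, t) \<in> sem P" "t r = y" "\<And>i. i < b \<Longrightarrow> i \<noteq> r \<Longrightarrow> t i = s i"
  using assms unfolding implements_def by metis

text \<open>The program writes 0 and 1 into two scratch registers and demands that they agree, so it
  has no run at all. This covers calls with too few arguments.\<close>

lemma implements_no_value: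
  assumes "\<And>s y. \<not> reval q (map s as) y"
  shows "\<exists>P. implements P q as r b"
proof
  show "implements (Seq (Instr (Asg b 0 b 0)) (Seq (Instr (Asg (Suc b) 0 b 1)) (Instr (Test b (Suc b)))))
    q as r b"
    using assms by (auto simp: implements_def)
qed

lemma map_frame: "(\<And>i. i < b \<Longrightarrow> t i = s i) \<Longrightarrow> \<forall>a \<in> set as. a < b \<Longrightarrow> map t as = map s as"
  by auto

section \<open>Register programs for the constructors of recursive functions\<close>

lemma implementable_Zf: "implementable Zf"
  unfolding implementable_def
proof (intro allI impI)
  fix as :: "nat list" and r b :: nat
  have "implements (Instr (Asg r 0 r 0)) Zf as r b"
    by (auto simp: implements_def intro: reval.zero elim: reval_Zf)
  then show "\<exists>P. implements P Zf as r b" ..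
qed

lemma implementable_Sf: "implementable Sf"
  unfolding implementable_def
proof (intro allI impI)
  fix as :: "nat list" and r b :: nat
  show "\<exists>P. implements P Sf as r b"
  proof (cases as)
    case Nil
    then show ?thesis by (intro implements_no_value) (auto elim: reval_Sf)
  next
    case (Cons a as')
    then have "implements (Instr (Asg r 1 a 1)) Sf as r b"
      by (auto simp: implements_def intro: reval.succ elim: reval_Sf)
    then show ?thesis ..
  qed
qed

lemma implementable_Proj: "implementable (Proj i)"
  unfolding implementable_def
proof (intro allI impI)
  fix as :: "nat list" and r b :: nat
  show "\<exists>P. implements P (Proj i) as r b"
  proof (cases "i < length as")
    case False
    then show ?thesis by (intro implements_no_value) (auto elim: reval_Proj)
  next
    case True
    then have "implements (Instr (Asg r 1 (as ! i) 0)) (Proj i) as r b"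
      by (auto simp: implements_def intro!: reval_ProjI elim: reval_Proj)
    then show ?thesis ..
  qed
qed

text \<open>The values go one after another into consecutive registers starting at \<open>c\<close>;
  raising \<open>c\<close> by one at each step protects the arguments and the values already
  found.\<close>

lemma implement_list:
  assumes "\<forall>g \<in> set gs. implementable g" "\<forall>a \<in> set as. a < c" "c + length gs \<le> b"
  shows "\<exists>P. (\<forall>s t. (s, t) \<in> sem P \<longrightarrow>
        list_all2 (\<lambda>g y. reval g (map s as) y) gs (map t [c..<c + length gs]) \<and> (\<forall>i<c. t i = s i)) \<and>
      (\<forall>s ys. list_all2 (\<lambda>g y. reval g (map s as) y) gs ys \<longrightarrow>
        (\<exists>t. (s, t) \<in> sem P \<and> map t [c..<c + length gs] = ys))"
  using assms
proof (induction gs arbitrary: c)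
  case Nil
  show ?case by (rule exI[of _ "Instr (Test 0 0)"]) auto
next
  case (Cons g gs)
  have "\<forall>a \<in> set as. a < b" "c < b"
    using Cons.prems by auto
  with Cons.prems obtain P where P: "implements P g as c b"
    unfolding implementable_def by (metis list.set_intros(1))
  from Cons.prems have "\<forall>a \<in> set as. a < Suc c" "Suc c + length gs \<le> b" "\<forall>g \<in> set gs. implementable g"
    by auto
  from Cons.IH[OF this(3,1,2)] obtain Q where
    Q1: "\<And>s t. (s, t) \<in> sem Q \<Longrightarrow>
        list_all2 (\<lambda>g y. reval g (map s as) y) gs (map t [Suc c..<Suc c + length gs])"
    and Q2: "\<And>s t i. (s, t) \<in> sem Q \<Longrightarrow> i < Suc c \<Longrightarrow> t i = s i"
    and Q3: "\<And>s ys. list_all2 (\<lambda>g y. reval g (map s as) y) gs ys \<Longrightarrow>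
        \<exists>t. (s, t) \<in> sem Q \<and> map t [Suc c..<Suc c + length gs] = ys"
    by blast
  have eq: "map u as = map s as" if "(s, u) \<in> sem P" for s u
    using implementsD(2)[OF P that] Cons.prems by (intro map_frame[of c]) auto
  have upt: "[c..<c + length (g # gs)] = c # [Suc c..<Suc c + length gs]"
    using upt_conv_Cons[of c "c + length (g # gs)"] by simp
  show ?case
  proof (rule exI[of _ "Seq P Q"], intro conjI allI impI)
    fix s t assume "(s, t) \<in> sem (Seq P Q)"
    then obtain u where u: "(s, u) \<in> sem P" "(u, t) \<in> sem Q" by auto
    show "list_all2 (\<lambda>g y. reval g (map s as) y) (g # gs) (map t [c..<c + length (g # gs)])"
      using implementsD(1)[OF P u(1)] Q1[OF u(2)] Q2[OF u(2), of c] eq[OF u(1)]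
      unfolding upt by simp
    show "t i = s i" if "i < c" for i
      using implementsD(2)[OF P u(1)] Q2[OF u(2)] that Cons.prems by simp
  next
    fix s ys assume "list_all2 (\<lambda>g y. reval g (map s as) y) (g # gs) ys"
    then obtain y ys' where ys: "ys = y # ys'" "reval g (map s as) y"
      "list_all2 (\<lambda>g y. reval g (map s as) y) gs ys'"
      by (cases ys) auto
    from P ys(2) obtain u where u: "(s, u) \<in> sem P" "u c = y"
      by (rule implements_run)
    from Q3[of u ys'] ys(3) eq[OF u(1)] obtain t where
      t: "(u, t) \<in> sem Q" "map t [Suc c..<Suc c + length gs] = ys'" by auto
    have "map t [c..<c + length (g # gs)] = ys"
      unfolding upt using t(2) Q2[OF t(1), of c] u(2) ys(1) by simp
    with u(1) t(1) show "\<exists>t. (s, t) \<in> sem (Seq P Q) \<and> map t [c..<c + length (g # gs)] = ys"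
      by auto
  qed
qed

lemma implementable_Comp:
  assumes "implementable f" "\<forall>g \<in> set gs. implementable g"
  shows "implementable (Comp f gs)"
  unfolding implementable_def
proof (intro allI impI)
  fix as :: "nat list" and r b :: nat
  assume as: "\<forall>a \<in> set as. a < b" and r: "r < b"
  let ?c = "b + length gs"
  obtain Q where
    Q1: "\<And>s t. (s, t) \<in> sem Q \<Longrightarrow> list_all2 (\<lambda>g y. reval g (map s as) y) gs (map t [b..<?c])"
    and Q2: "\<And>s t i. (s, t) \<in> sem Q \<Longrightarrow> i < b \<Longrightarrow> t i = s i"
    and Q3: "\<And>s ys. list_all2 (\<lambda>g y. reval g (map s as) y) gs ys \<Longrightarrow>
        \<exists>t. (s, t) \<in> sem Q \<and> map t [b..<?c] = ys"
    using implement_list[OF assms(2) as order.refl] by blast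
  have "\<forall>a \<in> set [b..<?c]. a < ?c" "r < ?c"
    using r by auto
  then obtain P where P: "implements P f [b..<?c] r ?c"
    using assms(1) unfolding implementable_def by blast
  have "implements (Seq Q P) (Comp f gs) as r b"
    unfolding implements_def
  proof (intro conjI allI impI)
    fix s t assume "(s, t) \<in> sem (Seq Q P)"
    then obtain u where u: "(s, u) \<in> sem Q" "(u, t) \<in> sem P" by auto
    show "reval (Comp f gs) (map s as) (t r)"
      using Q1[OF u(1)] implementsD(1)[OF P u(2)] by (rule reval.comp)
    show "t i = s i" if "i < b" "i \<noteq> r" for i
      using implementsD(2)[OF P u(2)] Q2[OF u(1)] that by simp
  next
    fix s y assume "reval (Comp f gs) (map s as) y"
    then obtain ys where ys: "list_all2 (\<lambda>g y. reval g (map s as) y) gs ys" "reval f ys y"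
      by (rule reval_Comp)
    from Q3[OF ys(1)] obtain u where u: "(s, u) \<in> sem Q" "map u [b..<?c] = ys" by blast
    from u(2) ys(2) have "reval f (map u [b..<?c]) y" by simp
    with P obtain t where "(u, t) \<in> sem P" "t r = y"
      by (rule implements_run)
    with u(1) show "\<exists>t. (s, t) \<in> sem (Seq Q P) \<and> t r = y" by auto
  qed
  then show "\<exists>P. implements P (Comp f gs) as r b" ..
qed

text \<open>A counter \<open>?c\<close> and the value \<open>?z\<close> of the recursion at that
  counter are kept in scratch registers; this relation between them is the loop invariant.\<close>

lemma implementable_Prec:
  assumes "implementable f" "implementable g"
  shows "implementable (Prec f g)"
  unfolding implementable_def
proof (intro allI impI)
  fix as :: "nat list" and r b :: nat
  assume as: "\<forall>a \<in> set as. a < b" and r: "r < b"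
  show "\<exists>P. implements P (Prec f g) as r b"
  proof (cases as)
    case Nil
    then show ?thesis by (intro implements_no_value) (auto elim: reval_Prec)
  next
    case (Cons a bs)
    have bs: "\<forall>a \<in> set bs. a < b" and a: "a < b"
      using as Cons by auto
    let ?c = b and ?z = "b + 1" and ?z' = "b + 2" and ?b = "b + 3"
    have "\<forall>a \<in> set bs. a < ?b" "?z < ?b" "\<forall>a \<in> set (?c # ?z # bs). a < ?b" "?z' < ?b"
      using bs by auto
    then obtain P Q where P: "implements P f bs ?z ?b" and Q: "implements Q g (?c # ?z # bs) ?z' ?b"
      using assms unfolding implementable_def by meson
    let ?init = "Seq (Instr (Asg ?c 0 ?c 0)) P"
    let ?body = "Seq Q (Seq (Instr (Asg ?z 1 ?z' 0)) (Instr (Asg ?c 1 ?c 1)))"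
    \<comment> \<open>\<open>Star\<close> may stop after any number of rounds; this test keeps only
      the runs whose counter has reached the recursion argument.\<close>
    let ?end = "Seq (Instr (Test ?c a)) (Instr (Asg r 1 ?z 0))"
    have init: "reval f (map s bs) (t ?z) \<and> t ?c = 0 \<and> (\<forall>i<b. t i = s i)"
      if "(s, t) \<in> sem ?init" for s t
    proof -
      from that have u: "(s(?c := 0), t) \<in> sem P" by simp
      have "map (s(?c := 0)) bs = map s bs" using bs by auto
      with implementsD[OF P u] show ?thesis by auto
    qed
    have body: "reval g (s ?c # s ?z # map s bs) (t ?z) \<and> t ?c = Suc (s ?c) \<and> (\<forall>i<b. t i = s i)"
      if "(s, t) \<in> sem ?body" for s t
    proof -
      from that obtain u where u: "(s, u) \<in> sem Q" and t: "t = u(?z := u ?z', ?c := Suc (u ?c))"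
        by auto
      show ?thesis
        using implementsD[OF Q u] t by auto
    qed
    have loop: "reval (Prec f g) (t ?c # map s bs) (t ?z) \<and> (\<forall>i<b. t i = s i)"
      if "(s, t) \<in> sem (Seq ?init (Star ?body))" for s t
    proof -
      from that obtain u where u: "(s, u) \<in> sem ?init" and "(u, t) \<in> (sem ?body)\<^sup>*" by auto
      from this(2) show ?thesis
      proof (induction rule: rtrancl_induct)
        case base
        show ?case using init[OF u] by (auto intro: reval.prec0)
      next
        case (step v t)
        have "map v bs = map s bs" using step.IH bs by (intro map_frame[of b]) auto
        with body[OF step.hyps(2)] step.IH show ?case by (auto intro: reval.precS)
      qed
    qed
    have loop_run: "\<exists>t. (s, t) \<in> sem (Seq ?init (Star ?body)) \<and> t ?c = n \<and> t ?z = y"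
      if "reval (Prec f g) (n # map s bs) y" for s n y
      using that
    proof (induction n arbitrary: y)
      case 0
      then have "reval f (map s bs) y" by (rule reval_Prec0)
      moreover have "map (s(?c := 0)) bs = map s bs" using bs by auto
      ultimately have "reval f (map (s(?c := 0)) bs) y" by metis
      with P obtain t where t: "(s(?c := 0), t) \<in> sem P" "t ?z = y"
        "\<And>i. i < ?b \<Longrightarrow> i \<noteq> ?z \<Longrightarrow> t i = (s(?c := 0)) i" by (rule implements_run) blast
      then have "(s, t) \<in> sem ?init" "t ?c = 0" by auto
      with t(2) show ?case by auto
    next
      case (Suc n)
      from Suc.prems obtain y' where y': "reval (Prec f g) (n # map s bs) y'" "reval g (n # y' # map s bs) y"
        by (rule reval_PrecS)
      from Suc.IH[OF y'(1)] obtain v where v: "(s, v) \<in> sem (Seq ?init (Star ?body))" "v ?c = n" "v ?z = y'"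
        by blast
      have "map v bs = map s bs" using loop[OF v(1)] bs by (intro map_frame[of b]) auto
      then have "map v (?c # ?z # bs) = n # y' # map s bs" using v(2,3) by simp
      with y'(2) have "reval g (map v (?c # ?z # bs)) y" by metis
      with Q obtain u where u: "(v, u) \<in> sem Q" "u ?z' = y"
        "\<And>i. i < ?b \<Longrightarrow> i \<noteq> ?z' \<Longrightarrow> u i = v i" by (rule implements_run) blast
      let ?t = "u(?z := u ?z', ?c := Suc (u ?c))"
      have "(v, ?t) \<in> sem ?body" using u(1) by auto
      with v(1) have "(s, ?t) \<in> sem (Seq ?init (Star ?body))"
        by (rule sem_Seq_Star)
      moreover have "?t ?c = Suc n" "?t ?z = y" using u v by auto
      ultimately show ?case by blast
    qed
    have "implements (Seq (Seq ?init (Star ?body)) ?end) (Prec f g) as r b"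
      unfolding implements_def
    proof (intro conjI allI impI)
      fix s t assume "(s, t) \<in> sem (Seq (Seq ?init (Star ?body)) ?end)"
      then obtain u where u: "(s, u) \<in> sem (Seq ?init (Star ?body))" and t: "u ?c = u a" "t = u(r := u ?z)"
        by (subst (asm) sem_Seq) auto
      have "u ?c = s a" using loop[OF u] t(1) a by simp
      then show "reval (Prec f g) (map s as) (t r)"
        using conjunct1[OF loop[OF u]] t(2) Cons by simp
      show "t i = s i" if "i < b" "i \<noteq> r" for i
        using loop[OF u] t that by simp
    next
      fix s y assume "reval (Prec f g) (map s as) y"
      then have "reval (Prec f g) (s a # map s bs) y" using Cons by simp
      from loop_run[OF this] obtain u where
        u: "(s, u) \<in> sem (Seq ?init (Star ?body))" "u ?c = s a" "u ?z = y" by blast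
      have "(u, u(r := u ?z)) \<in> sem ?end"
        using loop[OF u(1)] u(2) a by simp
      with u show "\<exists>t. (s, t) \<in> sem (Seq (Seq ?init (Star ?body)) ?end) \<and> t r = y"
        by (intro exI[of _ "u(r := u ?z)"]) (auto simp del: sem.simps)
    qed
    then show ?thesis ..
  qed
qed

lemma sem_Star_Inc: "(s, s(d := s d + n)) \<in> sem (Star (Instr (Asg d 1 d 1)))"
proof (induction n)
  case (Suc n)
  have "(s(d := s d + n), s(d := s d + Suc n)) \<in> sem (Instr (Asg d 1 d 1))" by simp
  with Suc show ?case unfolding sem.simps(3) by (rule rtrancl_into_rtrancl)
qed simp

lemma sem_Star_IncD: "(s, t) \<in> sem (Star (Instr (Asg d 1 d 1))) \<Longrightarrow> s d \<le> t d \<and> (\<forall>i. i \<noteq> d \<longrightarrow> t i = s i)"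
  unfolding sem.simps(3) by (induction rule: rtrancl_induct) auto

text \<open>Positivity is expressed by equality alone: \<open>d\<close> starts at 1, is incremented
  a guessed number of times and must then meet \<open>z\<close>.\<close>

definition pos_test :: "nat \<Rightarrow> nat \<Rightarrow> prog" where
  "pos_test d z = Seq (Instr (Asg d 0 d 1)) (Seq (Star (Instr (Asg d 1 d 1))) (Instr (Test d z)))"

lemma pos_testD:
  assumes "(s, t) \<in> sem (pos_test d z)" "d \<noteq> z"
  shows "0 < s z \<and> (\<forall>i. i \<noteq> d \<longrightarrow> t i = s i)"
proof -
  from assms obtain u where "(s(d := 1), t) \<in> sem (Star (Instr (Asg d 1 d 1)))" "t d = t z"
    unfolding pos_test_def by auto
  with sem_Star_IncD[OF this(1)] assms(2) show ?thesis by auto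
qed

lemma pos_test_run:
  assumes "0 < s z" "d \<noteq> z"
  shows "(s, s(d := s z)) \<in> sem (pos_test d z)"
  using sem_Star_Inc[of "s(d := 1)" d "s z - 1"] assms unfolding pos_test_def
  by (auto simp del: sem.simps)

lemma implementable_Mn:
  assumes "implementable f"
  shows "implementable (Mn f)"
  unfolding implementable_def
proof (intro allI impI)
  fix as :: "nat list" and r b :: nat
  assume as: "\<forall>a \<in> set as. a < b" and r: "r < b"
  let ?c = b and ?z = "b + 1" and ?d = "b + 2" and ?b = "b + 3"
  have "\<forall>a \<in> set (?c # as). a < ?b" "?z < ?b" using as by auto
  then obtain P where P: "implements P f (?c # as) ?z ?b"
    using assms unfolding implementable_def by meson
  let ?init = "Instr (Asg ?c 0 ?c 0)"
  let ?body = "Seq P (Seq (pos_test ?d ?z) (Instr (Asg ?c 1 ?c 1)))"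
  \<comment> \<open>The value at the final counter is computed once more and must be 0. The loop
    body let only positive values pass, so the counter is the least zero.\<close>
  let ?end = "Seq P (Seq (Instr (Asg ?d 0 ?d 0)) (Seq (Instr (Test ?z ?d)) (Instr (Asg r 1 ?c 0))))"
  have body: "(\<exists>y>0. reval f (s ?c # map s as) y) \<and> t ?c = Suc (s ?c) \<and> (\<forall>i<b. t i = s i)"
    if "(s, t) \<in> sem ?body" for s t
  proof -
    from that obtain u v where u: "(s, u) \<in> sem P" and v: "(u, v) \<in> sem (pos_test ?d ?z)"
      and t: "t = v(?c := Suc (v ?c))" by auto
    show ?thesis
      using implementsD[OF P u] pos_testD[OF v] t by auto
  qed
  have loop: "(\<forall>m<t ?c. \<exists>y>0. reval f (m # map s as) y) \<and> (\<forall>i<b. t i = s i)"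
    if "(s, t) \<in> sem (Seq ?init (Star ?body))" for s t
  proof -
    from that have "(s(?c := 0), t) \<in> (sem ?body)\<^sup>*" by simp
    then show ?thesis
    proof (induction rule: rtrancl_induct)
      case (step v t)
      have "map v as = map s as" using step.IH as by (intro map_frame[of b]) auto
      with body[OF step.hyps(2)] step.IH show ?case by (auto simp: less_Suc_eq)
    qed auto
  qed
  have loop_run: "\<exists>t. (s, t) \<in> sem (Seq ?init (Star ?body)) \<and> t ?c = n"
    if "\<forall>m<n. \<exists>y>0. reval f (m # map s as) y" for s n
    using that
  proof (induction n)
    case 0
    have "(s, s(?c := 0)) \<in> sem (Seq ?init (Star ?body))"
      by (rule sem_SeqI[of _ "s(?c := 0)"]) (simp, simp only: sem.simps(3) rtrancl.rtrancl_refl)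
    moreover have "(s(?c := 0)) ?c = 0" by simp
    ultimately show ?case by blast
  next
    case (Suc n)
    then obtain v where v: "(s, v) \<in> sem (Seq ?init (Star ?body))" "v ?c = n" by auto
    obtain y where y: "y > 0" "reval f (n # map s as) y" using Suc.prems by auto
    have "map v as = map s as" using loop[OF v(1)] as by (intro map_frame[of b]) auto
    then have "map v (?c # as) = n # map s as" using v(2) by simp
    with y(2) have "reval f (map v (?c # as)) y" by metis
    with P obtain u where u: "(v, u) \<in> sem P" "u ?z = y"
      "\<And>i. i < ?b \<Longrightarrow> i \<noteq> ?z \<Longrightarrow> u i = v i" by (rule implements_run) blast
    let ?t = "u(?d := u ?z, ?c := Suc (u ?c))"
    have "(u, u(?d := u ?z)) \<in> sem (pos_test ?d ?z)" using u(2) y(1) by (intro pos_test_run) auto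
    moreover have "(u(?d := u ?z), ?t) \<in> sem (Instr (Asg ?c 1 ?c 1))" by simp
    ultimately have "(v, ?t) \<in> sem ?body" using u(1) by (blast intro: sem_SeqI)
    with v(1) have "(s, ?t) \<in> sem (Seq ?init (Star ?body))"
      by (rule sem_Seq_Star)
    moreover have "?t ?c = Suc n" using u v by auto
    ultimately show ?case by blast
  qed
  have "implements (Seq (Seq ?init (Star ?body)) ?end) (Mn f) as r b"
    unfolding implements_def
  proof (intro conjI allI impI)
    fix s t assume "(s, t) \<in> sem (Seq (Seq ?init (Star ?body)) ?end)"
    then obtain u v where u: "(s, u) \<in> sem (Seq ?init (Star ?body))" and v: "(u, v) \<in> sem P"
      and t: "v ?z = 0" "t = v(?d := 0, r := v ?c)"
      using r by (subst (asm) sem_Seq) (auto simp del: sem.simps)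
    have "map u as = map s as" using loop[OF u] as by (intro map_frame[of b]) auto
    moreover have "reval f (u ?c # map u as) 0" using implementsD(1)[OF P v] t(1) by simp
    ultimately have "reval f (u ?c # map s as) 0" by metis
    moreover have "t r = u ?c" using implementsD(2)[OF P v, of b] t(2) by simp
    ultimately show "reval (Mn f) (map s as) (t r)"
      using loop[OF u] reval.mn by metis
    show "t i = s i" if "i < b" "i \<noteq> r" for i
      using loop[OF u] implementsD(2)[OF P v, of i] t that by simp
  next
    fix s y assume "reval (Mn f) (map s as) y"
    then have y: "reval f (y # map s as) 0" "\<forall>m<y. \<exists>y>0. reval f (m # map s as) y"
      by (auto elim: reval_Mn)
    from loop_run[OF y(2)] obtain u where
      u: "(s, u) \<in> sem (Seq ?init (Star ?body))" "u ?c = y" by blast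
    have "map u as = map s as" using loop[OF u(1)] as by (intro map_frame[of b]) auto
    then have "map u (?c # as) = y # map s as" using u(2) by simp
    with y(1) have "reval f (map u (?c # as)) 0" by metis
    with P obtain v where v: "(u, v) \<in> sem P" "v ?z = 0"
      "\<And>i. i < ?b \<Longrightarrow> i \<noteq> ?z \<Longrightarrow> v i = u i" by (rule implements_run) blast
    have "(u, v(?d := 0, r := v ?c)) \<in> sem ?end" using v(1,2) by auto
    with u v(3)[of b] show "\<exists>t. (s, t) \<in> sem (Seq (Seq ?init (Star ?body)) ?end) \<and> t r = y"
      by (intro exI[of _ "v(?d := 0, r := v ?c)"]) (auto simp del: sem.simps)
  qed
  then show "\<exists>P. implements P (Mn f) as r b" ..
qed

lemma implementable: "implementable q"
  by (induction q) (blast intro: implementable_Zf implementable_Sf implementable_Proj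
      implementable_Comp implementable_Prec implementable_Mn)+

text \<open>The output register is compared with a register set to 0. Acceptance depends on
  registers 0 and 1 only, whatever the others hold at the start.\<close>

lemma accepting_program:
  "\<exists>P. \<forall>s. (\<exists>t. (s, t) \<in> sem P) \<longleftrightarrow> reval q [s 0, s 1] 0"
proof -
  have "\<forall>a \<in> set [0, 1]. a < (3 :: nat)" "(2 :: nat) < 3" by auto
  then obtain P where P: "implements P q [0, 1] 2 3"
    using implementable[of q] unfolding implementable_def by blast
  have "(\<exists>t. (s, t) \<in> sem (Seq P (Seq (Instr (Asg 3 0 3 0)) (Instr (Test 2 3))))) \<longleftrightarrow> reval q [s 0, s 1] 0" for s
    using P unfolding implements_def by (auto simp: fun_upd_def) metis
  then show ?thesis by blast
qed

section \<open>Flowcharts driven by digits\<close>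

text \<open>In a node $(a, x, y)$ the instruction $a$ is executed, and the digit being read selects the
  successor: $x$ for 0 and $y$ for any other digit.\<close>

type_synonym node = "instr \<times> nat \<times> nat"

text \<open>Addresses are absolute: \<open>l\<close> is the address of the first node, and the exit
  is the address just behind the last one. \<open>Test 0 0\<close> serves as a no-op; in a loop the
  first node chooses between body and exit, and the last one jumps back.\<close>

fun code :: "prog \<Rightarrow> nat \<Rightarrow> node list" where
  "code (Instr a) l = [(a, Suc l, Suc l)]"
| "code (Seq P Q) l = (let N = code P l in N @ code Q (l + length N))"
| "code (Star P) l = (let N = code P (Suc l); e = Suc (Suc (l + length N)) in
     (Test 0 0, Suc l, e) # N @ [(Test 0 0, l, l)])"

lemma code_target: "(a, x, y) \<in> set (code P l) \<Longrightarrow> x \<in> {l..l + length (code P l)} \<and> y \<in> {l..l + length (code P l)}"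
proof (induction P arbitrary: l)
  case (Seq P Q)
  then show ?case by (fastforce simp: Let_def)
next
  case (Star P)
  then show ?case by (fastforce simp: Let_def)
qed auto

section \<open>Agreement of flowcharts with the programs they come from\<close>

definition flow :: "node list \<Rightarrow> ((nat \<times> (nat \<Rightarrow> nat)) \<times> (nat \<times> (nat \<Rightarrow> nat))) set" where
  "flow N = {((l, s), (l', exec a s)) |l s l' a x y.
     l < length N \<and> N ! l = (a, x, y) \<and> defect a s = 0 \<and> l' \<in> {x, y}}"

lemma flowI:
  "l < length N \<Longrightarrow> N ! l = (a, x, y) \<Longrightarrow> defect a s = 0 \<Longrightarrow> l' = x \<or> l' = y \<Longrightarrow>
    ((l, s), (l', exec a s)) \<in> flow N"
  unfolding flow_def by blast

text \<open>The surrounding \<open>pre\<close> and \<open>post\<close> let the induction hypotheses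
  speak about pieces of one fixed flowchart \<open>N\<close> with its absolute addresses.\<close>

lemma flow_complete:
  assumes "(s, t) \<in> sem P" "N = pre @ code P (length pre) @ post"
  shows "((length pre, s), (length pre + length (code P (length pre)), t)) \<in> (flow N)\<^sup>*"
  using assms
proof (induction P arbitrary: s t pre post)
  case (Instr a)
  then have a: "defect a s = 0" "t = exec a s" by (auto simp: sem.simps)
  have "((length pre, s), (Suc (length pre), t)) \<in> flow N"
    unfolding a(2) by (rule flowI) (use a(1) Instr.prems(2) in auto)
  then show ?case by auto
next
  case (Seq P Q)
  from Seq.prems(1) obtain u where u: "(s, u) \<in> sem P" "(u, t) \<in> sem Q" by auto
  let ?l = "length pre + length (code P (length pre))"
  have "N = (pre @ code P (length pre)) @ code Q (length (pre @ code P (length pre))) @ post"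
    using Seq.prems(2) by (simp add: Let_def)
  from Seq.IH(2)[OF u(2) this] have "((?l, u), (?l + length (code Q ?l), t)) \<in> (flow N)\<^sup>*" by simp
  moreover have "((length pre, s), (?l, u)) \<in> (flow N)\<^sup>*"
    using Seq.prems(2) by (intro Seq.IH(1)[OF u(1)]) (simp add: Let_def)
  ultimately show ?case by (auto simp: Let_def add.assoc)
next
  case (Star P)
  let ?l = "length pre"
  let ?C = "code P (Suc ?l)"
  let ?e = "Suc (?l + length ?C)"
  have N: "N = (pre @ [(Test 0 0, Suc ?l, Suc ?e)]) @ code P (length (pre @ [(Test 0 0, Suc ?l, Suc ?e)]))
      @ ((Test 0 0, ?l, ?l) # post)"
    using Star.prems(2) by (simp add: Let_def)
  have entry: "((?l, u), (x, exec (Test 0 0) u)) \<in> flow N" if "x = Suc ?l \<or> x = Suc ?e" for u x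
    by (rule flowI[where x = "Suc ?l" and y = "Suc ?e"]) (use that N in \<open>auto simp: nth_append\<close>)
  have ret: "((?e, u), (?l, exec (Test 0 0) u)) \<in> flow N" for u
    by (rule flowI[where x = ?l and y = ?l]) (use N in \<open>auto simp: nth_append\<close>)
  from Star.prems(1) have "(s, t) \<in> (sem P)\<^sup>*" by simp
  then have "((?l, s), (?l, t)) \<in> (flow N)\<^sup>*"
  proof (induction rule: rtrancl_induct)
    case (step u v)
    from Star.IH[OF step.hyps(2) N] have "((Suc ?l, u), (?e, v)) \<in> (flow N)\<^sup>*" by simp
    with entry[of "Suc ?l" u] ret[of v] have "((?l, u), (?l, v)) \<in> (flow N)\<^sup>*"
      by (auto intro: converse_rtrancl_into_rtrancl rtrancl_into_rtrancl)
    with step.IH show ?case by (rule rtrancl_trans)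
  qed simp
  with entry[of "Suc ?e" t] have "((?l, s), (Suc ?e, t)) \<in> (flow N)\<^sup>*"
    by (auto intro: rtrancl_into_rtrancl)
  then show ?case by (simp add: Let_def)
qed

text \<open>The label of a location consists of the states from which the exit can be reached within $K$.\<close>

lemma code_labelling:
  "\<exists>\<Phi>. \<Phi> l = (sem P)\<inverse> `` K \<and> \<Phi> (l + length (code P l)) = K \<and>
     (\<forall>i a x y s. i < length (code P l) \<longrightarrow> code P l ! i = (a, x, y) \<longrightarrow> defect a s = 0 \<longrightarrow>
        exec a s \<in> \<Phi> x \<union> \<Phi> y \<longrightarrow> s \<in> \<Phi> (l + i))"
proof (induction P arbitrary: l K)
  case (Instr a)
  show ?case
    by (rule exI[of _ "\<lambda>i. if i = l then (sem (Instr a))\<inverse> `` K else K"]) (auto simp: sem.simps)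
next
  case (Seq P Q)
  let ?N = "code P l"
  let ?m = "l + length ?N"
  obtain \<Psi> where \<Psi>: "\<Psi> ?m = (sem Q)\<inverse> `` K" "\<Psi> (?m + length (code Q ?m)) = K"
    "\<And>i a x y s. i < length (code Q ?m) \<Longrightarrow> code Q ?m ! i = (a, x, y) \<Longrightarrow> defect a s = 0 \<Longrightarrow>
        exec a s \<in> \<Psi> x \<union> \<Psi> y \<Longrightarrow> s \<in> \<Psi> (?m + i)"
    using Seq.IH(2)[of ?m K] by blast
  obtain \<Phi> where \<Phi>: "\<Phi> l = (sem P)\<inverse> `` (sem Q)\<inverse> `` K" "\<Phi> ?m = (sem Q)\<inverse> `` K"
    "\<And>i a x y s. i < length ?N \<Longrightarrow> ?N ! i = (a, x, y) \<Longrightarrow> defect a s = 0 \<Longrightarrow>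
        exec a s \<in> \<Phi> x \<union> \<Phi> y \<Longrightarrow> s \<in> \<Phi> (l + i)"
    using Seq.IH(1)[of l "(sem Q)\<inverse> `` K"] by blast
  \<comment> \<open>The two labellings agree at \<open>?m\<close> and can be glued there; by
    \<open>code_target\<close>, each node sees only labels of its own piece.\<close>
  define \<Theta> where "\<Theta> i = (if i < ?m then \<Phi> i else \<Psi> i)" for i
  have le: "\<Theta> i = \<Phi> i" if "i \<le> ?m" for i
    using that \<Phi>(2) \<Psi>(1) by (auto simp: \<Theta>_def)
  have ge: "\<Theta> i = \<Psi> i" if "i \<ge> ?m" for i
    using that by (auto simp: \<Theta>_def)
  show ?case
  proof (intro exI[of _ \<Theta>] conjI allI impI)
    show "\<Theta> l = (sem (Seq P Q))\<inverse> `` K"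
      using le[of l] \<Phi>(1) by (auto simp: sem.simps)
    show "\<Theta> (l + length (code (Seq P Q) l)) = K"
      using ge[of "?m + length (code Q ?m)"] \<Psi>(2) by (simp add: Let_def add.assoc)
  next
    fix i a x y s
    assume i: "i < length (code (Seq P Q) l)" "code (Seq P Q) l ! i = (a, x, y)"
      and d: "defect a s = 0" "exec a s \<in> \<Theta> x \<union> \<Theta> y"
    show "s \<in> \<Theta> (l + i)"
    proof (cases "i < length ?N")
      case True
      with i have C: "?N ! i = (a, x, y)" by (simp add: Let_def nth_append)
      then have "(a, x, y) \<in> set ?N" using True by (metis nth_mem)
      from code_target[OF this] d(2) have "exec a s \<in> \<Phi> x \<union> \<Phi> y" using le by auto
      from \<Phi>(3)[OF True C d(1) this] show ?thesis using le[of "l + i"] True by simp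
    next
      case False
      let ?j = "i - length ?N"
      from False i have C: "?j < length (code Q ?m)" "code Q ?m ! ?j = (a, x, y)"
        by (auto simp: Let_def nth_append)
      then have "(a, x, y) \<in> set (code Q ?m)" by (metis nth_mem)
      from code_target[OF this] d(2) have "exec a s \<in> \<Psi> x \<union> \<Psi> y" using ge by auto
      from \<Psi>(3)[OF C d(1) this] show ?thesis using ge[of "l + i"] False by simp
    qed
  qed
next
  case (Star P)
  let ?N = "code P (Suc l)"
  let ?e = "Suc (l + length ?N)"
  \<comment> \<open>The states from which iterating the body can lead into \<open>K\<close>. They
    label the head of the loop and also the end of its body, so the induction hypothesis is used
    with \<open>?W\<close> in place of \<open>K\<close>.\<close>
  let ?W = "((sem P)\<^sup>*)\<inverse> `` K"
  obtain \<Phi> where \<Phi>: "\<Phi> (Suc l) = (sem P)\<inverse> `` ?W" "\<Phi> (Suc l + length ?N) = ?W"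
    "\<And>i a x y s. i < length ?N \<Longrightarrow> ?N ! i = (a, x, y) \<Longrightarrow> defect a s = 0 \<Longrightarrow>
        exec a s \<in> \<Phi> x \<union> \<Phi> y \<Longrightarrow> s \<in> \<Phi> (Suc l + i)"
    using Star.IH[of "Suc l" ?W] by blast
  define \<Theta> where "\<Theta> i = (if i = l then ?W else if i = Suc ?e then K else \<Phi> i)" for i
  have mid: "\<Theta> i = \<Phi> i" if "i > l" "i \<le> ?e" for i
    using that by (auto simp: \<Theta>_def)
  have W: "(sem P)\<inverse> `` ?W \<subseteq> ?W" "K \<subseteq> ?W"
    by (auto intro: converse_rtrancl_into_rtrancl)
  show ?case
  proof (intro exI[of _ \<Theta>] conjI allI impI)
    show "\<Theta> l = (sem (Star P))\<inverse> `` K" "\<Theta> (l + length (code (Star P) l)) = K"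
      by (auto simp: \<Theta>_def Let_def)
  next
    fix i a x y s
    assume i: "i < length (code (Star P) l)" "code (Star P) l ! i = (a, x, y)"
      and d: "defect a s = 0" "exec a s \<in> \<Theta> x \<union> \<Theta> y"
    consider "i = 0" | "i = Suc (length ?N)" | j where "i = Suc j" "j < length ?N"
      using i(1) by (cases i) (auto simp: Let_def less_Suc_eq)
    then show "s \<in> \<Theta> (l + i)"
    proof cases
      case 1
      with i have "a = Test 0 0" "x = Suc l" "y = Suc ?e" by (auto simp: Let_def)
      moreover have "\<Theta> (Suc l) \<subseteq> ?W" using mid[of "Suc l"] \<Phi>(1) W(1) by simp
      moreover have "\<Theta> (Suc ?e) \<subseteq> ?W" using W(2) by (simp add: \<Theta>_def)
      ultimately have "s \<in> ?W" using d(2) by auto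
      then show ?thesis using 1 by (simp add: \<Theta>_def)
    next
      case 2
      with i have "a = Test 0 0" "x = l" "y = l" by (auto simp: Let_def nth_append)
      with d(2) have "s \<in> ?W" by (simp add: \<Theta>_def)
      then show ?thesis using mid[of ?e] \<Phi>(2) 2 by simp
    next
      case (3 j)
      with i have C: "?N ! j = (a, x, y)" by (simp add: Let_def nth_append)
      then have "(a, x, y) \<in> set ?N" using 3 by (metis nth_mem)
      from code_target[OF this] d(2) have "exec a s \<in> \<Phi> x \<union> \<Phi> y" using mid by auto
      from \<Phi>(3)[OF 3(2) C d(1) this] show ?thesis using mid[of "l + i"] 3 by simp
    qed
  qed
qed

text \<open>Label the exit with the single state \<open>t\<close> and follow the run backwards: each
  configuration lies in the label of its location, in particular the initial one.\<close>

lemma flow_sound: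
  assumes "((0, s), (length (code P 0), t)) \<in> (flow (code P 0))\<^sup>*"
  shows "(s, t) \<in> sem P"
proof -
  obtain \<Phi> where \<Phi>: "\<Phi> 0 = (sem P)\<inverse> `` {t}" "\<Phi> (length (code P 0)) = {t}"
    "\<And>i a x y s. i < length (code P 0) \<Longrightarrow> code P 0 ! i = (a, x, y) \<Longrightarrow> defect a s = 0 \<Longrightarrow>
        exec a s \<in> \<Phi> x \<union> \<Phi> y \<Longrightarrow> s \<in> \<Phi> i"
    using code_labelling[of 0 P "{t}"] unfolding add_0 by blast
  have "snd c \<in> \<Phi> (fst c)" if "(c, (length (code P 0), t)) \<in> (flow (code P 0))\<^sup>*" for c
    using that
  proof (induction rule: converse_rtrancl_induct)
    case base
    show ?case using \<Phi>(2) by simp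
  next
    case (step c c')
    from step.hyps(1) obtain l s l' a x y where "c = (l, s)" "c' = (l', exec a s)"
      "l < length (code P 0)" "code P 0 ! l = (a, x, y)" "defect a s = 0" "l' \<in> {x, y}"
      unfolding flow_def by blast
    with step.IH \<Phi>(3)[of l a x y s] show ?case by auto
  qed
  from this[OF assms] \<Phi>(1) show ?thesis by auto
qed

text \<open>Outside the code every location is a no-op that loops to itself, so the exit is
  absorbing and costs nothing.\<close>

definition node :: "node list \<Rightarrow> nat \<Rightarrow> node" where
  "node N l = (if l < length N then N ! l else (Test 0 0, l, l))"

definition target :: "node list \<Rightarrow> nat \<Rightarrow> nat \<Rightarrow> nat" where
  "target N l d = (case node N l of (a, x, y) \<Rightarrow> if d = 0 then x else y)"

definition action :: "node list \<Rightarrow> nat \<Rightarrow> instr" where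
  "action N l = fst (node N l)"

text \<open>Location, registers and the defects summed so far. A failed test now costs a penalty
  instead of blocking, so every digit string has exactly one run.\<close>

type_synonym config = "nat \<times> (nat \<Rightarrow> nat) \<times> int"

fun move :: "node list \<Rightarrow> config \<Rightarrow> nat \<Rightarrow> config" where
  "move N (l, s, p) d = (target N l d, exec (action N l) s, p + defect (action N l) s)"

lemma defect_nonneg: "defect a s \<ge> 0"
  by (cases a) auto

lemma run_penalty_mono: "snd (snd c) \<le> snd (snd (foldl (move N) c ds))"
proof (induction ds rule: rev_induct)
  case (snoc d ds)
  then show ?case
    using defect_nonneg by (cases "foldl (move N) c ds") (fastforce intro: order_trans)
qed simp

text \<open>Penalties never decrease, so a final penalty 0 forces every defect on the way to be 0;
  then each move is a step of the flow or an idle round outside the code.\<close>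

lemma run_flow:
  assumes "foldl (move N) (l, s, 0) ds = (length N, t, 0)"
  shows "((l, s), (length N, t)) \<in> (flow N)\<^sup>*"
  using assms
proof (induction ds arbitrary: l s)
  case (Cons d ds)
  let ?a = "action N l"
  have "0 + defect ?a s \<le> 0"
    using run_penalty_mono[of "move N (l, s, 0) d" N ds] Cons.prems by simp
  then have def: "defect ?a s = 0" using defect_nonneg[of ?a s] by simp
  then have "((target N l d, exec ?a s), (length N, t)) \<in> (flow N)\<^sup>*"
    using Cons by simp
  moreover have "((l, s), (target N l d, exec ?a s)) \<in> (flow N)\<^sup>*"
  proof (cases "l < length N")
    case True
    with def show ?thesis
      by (intro r_into_rtrancl flowI[of l N _ "fst (snd (node N l))" "snd (snd (node N l))"])
        (auto simp: action_def target_def node_def split: prod.splits)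
  qed (auto simp: action_def target_def node_def)
  ultimately show ?case by (rule rtrancl_trans[rotated])
qed simp

lemma flow_run:
  assumes "((l, s), (l', t)) \<in> (flow N)\<^sup>*"
  shows "\<exists>ds. set ds \<subseteq> {0, 1} \<and> foldl (move N) (l, s, p) ds = (l', t, p)"
  using assms
proof (induction rule: rtrancl_induct2)
  case refl
  show ?case by (intro exI[of _ "[]"]) simp
next
  case (step m u l' t)
  then obtain ds where ds: "set ds \<subseteq> {0, 1}" "foldl (move N) (l, s, p) ds = (m, u, p)" by blast
  from step.hyps(2) obtain a x y where a: "m < length N" "N ! m = (a, x, y)" "defect a u = 0"
    "t = exec a u" "l' \<in> {x, y}"
    unfolding flow_def by blast
  \<comment> \<open>The digits 0 and 1 suffice to name the chosen successor, which is why one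
    construction serves every base.\<close>
  have "move N (m, u, p) (if l' = x then 0 else 1) = (l', t, p)"
    using a by (auto simp: action_def target_def node_def)
  then show ?case
    using ds by (intro exI[of _ "ds @ [if l' = x then 0 else 1]"]) auto
qed

definition reads :: "prog \<Rightarrow> (nat \<Rightarrow> nat) \<Rightarrow> nat list \<Rightarrow> config" where
  "reads P s ds = foldl (move (code P 0)) (0, s, 0) ds"

lemma sem_reads:
  assumes "(s, t) \<in> sem P"
  shows "\<exists>ds. set ds \<subseteq> {0, 1} \<and> reads P s ds = (length (code P 0), t, 0)"
proof -
  have "((0, s), (length (code P 0), t)) \<in> (flow (code P 0))\<^sup>*"
    using flow_complete[OF assms, of "code P 0" "[]" "[]"] by simp
  from flow_run[OF this] show ?thesis unfolding reads_def by blast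
qed

lemma reads_sem: "reads P s ds = (length (code P 0), t, 0) \<Longrightarrow> (s, t) \<in> sem P"
  unfolding reads_def by (rule flow_sound[OF run_flow])

section \<open>Parametrised regular sequences\<close>

text \<open>Integer-valued functions form a module over the integers. Spans over the integers, not
  over a field, are what yields integer matrix entries.\<close>

interpretation fm: module "\<lambda>(c :: int) (f :: 'a \<Rightarrow> int) x. c * f x"
  by standard (auto simp: fun_eq_iff algebra_simps)

lemma sum_fun_eq: "sum f A = (\<lambda>x. \<Sum>a \<in> A. f a x)" for f :: "'b \<Rightarrow> 'a \<Rightarrow> int"
  by (induction A rule: infinite_finite_induct) (auto simp: fun_eq_iff)

lemma span_addI: "f \<in> fm.span S \<Longrightarrow> g \<in> fm.span S \<Longrightarrow> (\<lambda>x. f x + g x) \<in> fm.span S"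
  using fm.span_add[of f S g] by (simp add: plus_fun_def)

lemma span_scaleI: "f \<in> fm.span S \<Longrightarrow> (\<lambda>x. c * f x) \<in> fm.span S"
  by (rule fm.span_scale)

lemma span_zeroI: "(\<lambda>x. 0) \<in> fm.span S"
  using fm.span_zero[of S] by (simp add: zero_fun_def)

lemma span_sumI: "(\<And>a. a \<in> A \<Longrightarrow> f a \<in> fm.span S) \<Longrightarrow> (\<lambda>x. \<Sum>a \<in> A. f a x) \<in> fm.span S"
  using fm.span_sum[of A f S] by (simp add: sum_fun_eq)

text \<open>Substituting \<open>h\<close> and multiplying by \<open>m\<close> is linear in
  \<open>f\<close>, so the generators decide.\<close>

lemma span_pullback:
  assumes "f \<in> fm.span S" "\<And>g. g \<in> S \<Longrightarrow> (\<lambda>y. m y * g (h y)) \<in> fm.span T"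
  shows "(\<lambda>y. m y * f (h y)) \<in> fm.span T"
  using assms(1)
proof (induction rule: fm.span_induct_alt)
  case base
  show ?case using span_zeroI by simp
next
  case (step c g f)
  show ?case
    using span_addI[OF span_scaleI[OF assms(2)[OF step.hyps(1)], of c] step.IH]
    by (simp add: algebra_simps)
qed

lemmas span_comp = span_pullback[where m = "\<lambda>_. 1", simplified]

lemma span_subset: "S \<subseteq> fm.span T \<Longrightarrow> f \<in> fm.span S \<Longrightarrow> f \<in> fm.span T"
  using span_comp[of f S "\<lambda>x. x" T] by auto

text \<open>Bilinearity: \<open>span_pullback\<close> is used once in each factor.\<close>

lemma span_mult:
  assumes "f \<in> fm.span S" "g \<in> fm.span T"
  shows "(\<lambda>x. f x * g x) \<in> fm.span {\<lambda>x. a x * b x |a b. a \<in> S \<and> b \<in> T}" (is "_ \<in> fm.span ?U")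
proof -
  have "(\<lambda>x. a x * g x) \<in> fm.span ?U" if "a \<in> S" for a
    using assms(2) by (rule span_pullback) (use that in \<open>auto intro: fm.span_base\<close>)
  then have "(\<lambda>x. g x * f x) \<in> fm.span ?U"
    by (intro span_pullback[OF assms(1)]) (auto simp: mult.commute)
  then show ?thesis by (simp add: mult.commute)
qed

lemma span_list:
  assumes "f \<in> fm.span (set fs)"
  shows "\<exists>c. \<forall>x. f x = (\<Sum>i<length fs. c i * (fs ! i) x)"
  using assms
proof (induction rule: fm.span_induct_alt)
  case base
  show ?case by (rule exI[of _ "\<lambda>_. 0"]) simp
next
  case (step c g f)
  then obtain e where e: "\<And>x. f x = (\<Sum>i<length fs. e i * (fs ! i) x)" by blast
  from step.hyps obtain j where j: "j < length fs" "g = fs ! j" by (auto simp: in_set_conv_nth)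
  \<comment> \<open>The coefficient \<open>c\<close> is added at the one position \<open>j\<close>,
    even if \<open>g\<close> occurs in the list several times.\<close>
  have "c * g x + f x = (\<Sum>i<length fs. (e i + (if i = j then c else 0)) * (fs ! i) x)" for x
    using j by (simp add: e distrib_right sum.distrib if_distrib[where f = "\<lambda>a. a * z" for z] sum.delta cong: if_cong)
  then show ?case by auto
qed

text \<open>The degree bound applies to each variable separately. A list in fixed order is used
  because its values become the beginning of the row vector.\<close>

definition monomials :: "nat \<Rightarrow> (nat \<times> nat \<Rightarrow> int) list" where
  "monomials D = map (\<lambda>(i, j) x. int (fst x ^ i * snd x ^ j)) (List.product [0..<Suc D] [0..<Suc D])"

lemma set_monomials: "set (monomials D) = {\<lambda>x. int (fst x ^ i * snd x ^ j) |i j. i \<le> D \<and> j \<le> D}"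
proof -
  have "set (monomials D) = (\<lambda>(i, j) x. int (fst x ^ i * snd x ^ j)) ` ({..D} \<times> {..D})"
    by (simp only: monomials_def set_map set_product set_upt atLeast0LessThan lessThan_Suc_atMost)
  then show ?thesis by (auto simp del: of_nat_mult of_nat_power)
qed

lemma monomial_in_span: "i \<le> D \<Longrightarrow> j \<le> D \<Longrightarrow> (\<lambda>x. int (fst x ^ i * snd x ^ j)) \<in> fm.span (set (monomials D))"
  by (rule fm.span_base) (auto simp: set_monomials)

lemma monomials_mono: "D \<le> D' \<Longrightarrow> fm.span (set (monomials D)) \<subseteq> fm.span (set (monomials D'))"
  by (rule fm.span_mono) (fastforce simp: set_monomials)

lemma monomials_mult:
  assumes "f \<in> fm.span (set (monomials D))" "g \<in> fm.span (set (monomials D'))"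
  shows "(\<lambda>x. f x * g x) \<in> fm.span (set (monomials (D + D')))"
proof (rule span_subset[OF _ span_mult[OF assms]], rule subsetI)
  fix h assume "h \<in> {\<lambda>x. a x * b x |a b. a \<in> set (monomials D) \<and> b \<in> set (monomials D')}"
  then obtain i j i' j' where h: "i \<le> D" "j \<le> D" "i' \<le> D'" "j' \<le> D'"
    "h = (\<lambda>x. int (fst x ^ i * snd x ^ j) * int (fst x ^ i' * snd x ^ j'))"
    by (auto simp: set_monomials)
  then have "h = (\<lambda>x. int (fst x ^ (i + i') * snd x ^ (j + j')))"
    by (auto simp: fun_eq_iff power_add)
  with h show "h \<in> fm.span (set (monomials (D + D')))"
    using monomial_in_span[of "i + i'" "D + D'" "j + j'"] by simp
qed

text \<open>Two parameters and a digit string, lowest digit first. Appending a digit at the end then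
  corresponds to multiplying the row vector by one more matrix on the right.\<close>

type_synonym family = "(nat \<times> nat) \<times> nat list \<Rightarrow> int"

definition snoc :: "nat \<Rightarrow> (nat \<times> nat) \<times> nat list \<Rightarrow> (nat \<times> nat) \<times> nat list" where
  "snoc d y = (fst y, snd y @ [d])"

text \<open>Only the initial values of the generators depend on the parameters, and they do so polynomially
  of degree at most $D$ in each; the transition coefficients are constant integers.\<close>

definition closed_gens :: "nat \<Rightarrow> nat \<Rightarrow> family set \<Rightarrow> bool" where
  "closed_gens k D S \<longleftrightarrow> finite S \<and> (\<forall>g \<in> S. (\<lambda>x. g (x, [])) \<in> fm.span (set (monomials D)) \<and>
      (\<forall>d<k. (\<lambda>y. g (snoc d y)) \<in> fm.span S))"

text \<open>A form of the characterisation of regular sequences by a finitely generated module that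
  is stable under reading a digit, here uniform in the parameters.\<close>

definition regular :: "nat \<Rightarrow> nat \<Rightarrow> family \<Rightarrow> bool" where
  "regular k D f \<longleftrightarrow> (\<exists>S. closed_gens k D S \<and> f \<in> fm.span S)"

lemma closed_gens_span:
  assumes "closed_gens k D S" "f \<in> fm.span S"
  shows "(\<lambda>x. f (x, [])) \<in> fm.span (set (monomials D))"
    and "d < k \<Longrightarrow> (\<lambda>y. f (snoc d y)) \<in> fm.span S"
  using assms span_comp[OF assms(2), of "\<lambda>x. (x, [])"] span_comp[OF assms(2), of "snoc d"]
  unfolding closed_gens_def by blast+

lemma closed_gens_mono: "closed_gens k D S \<Longrightarrow> D \<le> D' \<Longrightarrow> closed_gens k D' S"
  unfolding closed_gens_def using monomials_mono by blast

section \<open>Closure properties of regular families\<close>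

lemma regular_mono: "regular k D f \<Longrightarrow> D \<le> D' \<Longrightarrow> regular k D' f"
  unfolding regular_def using closed_gens_mono by blast

lemma regular_scale: "regular k D f \<Longrightarrow> regular k D (\<lambda>y. c * f y)"
  unfolding regular_def using span_scaleI by blast

lemma closed_gens_Un:
  assumes "closed_gens k D S" "closed_gens k D T"
  shows "closed_gens k D (S \<union> T)"
proof -
  have "fm.span S \<subseteq> fm.span (S \<union> T)" "fm.span T \<subseteq> fm.span (S \<union> T)"
    by (auto intro!: fm.span_mono)
  with assms show ?thesis unfolding closed_gens_def by blast
qed

lemma regular_add:
  assumes "regular k D f" "regular k D g"
  shows "regular k D (\<lambda>y. f y + g y)"
proof -
  from assms obtain S T where S: "closed_gens k D S" "f \<in> fm.span S" and T: "closed_gens k D T" "g \<in> fm.span T"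
    unfolding regular_def by blast
  have "f \<in> fm.span (S \<union> T)" "g \<in> fm.span (S \<union> T)"
    using S(2) T(2) fm.span_mono[of S "S \<union> T"] fm.span_mono[of T "S \<union> T"] by auto
  with closed_gens_Un[OF S(1) T(1)] show ?thesis
    unfolding regular_def by (blast intro: span_addI)
qed

lemma regular_const: "regular k D (\<lambda>y. c)"
proof -
  have one: "closed_gens k D {\<lambda>y. 1}"
    using monomial_in_span[of 0 D 0] unfolding closed_gens_def by (auto intro: fm.span_base)
  have "regular k D (\<lambda>y. 1)"
    unfolding regular_def by (rule exI, rule conjI, rule one) (auto intro: fm.span_base)
  from regular_scale[OF this, of c] show ?thesis by simp
qed

lemma regular_sum:
  assumes "finite A" "\<And>a. a \<in> A \<Longrightarrow> regular k D (f a)"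
  shows "regular k D (\<lambda>y. \<Sum>a \<in> A. f a y)"
  using assms by (induction A rule: finite_induct) (auto intro: regular_const regular_add)

lemma regular_diff: "regular k D f \<Longrightarrow> regular k D g \<Longrightarrow> regular k D (\<lambda>y. f y - g y)"
  using regular_add[OF _ regular_scale[of k D g "-1"], of f] by simp

text \<open>The pairwise products of generators are again closed, as in a tensor product of
  representations; the degrees of the initial values add up.\<close>

lemma regular_mult:
  assumes "regular k D f" "regular k D' g"
  shows "regular k (D + D') (\<lambda>y. f y * g y)"
proof -
  from assms obtain S T where S: "closed_gens k D S" "f \<in> fm.span S" and T: "closed_gens k D' T" "g \<in> fm.span T"
    unfolding regular_def by blast
  let ?U = "{\<lambda>x. a x * b x |a b. a \<in> S \<and> b \<in> T}"
  have "?U = (\<lambda>(a, b) x. a x * b x) ` (S \<times> T)" by auto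
  with S(1) T(1) have "finite ?U" unfolding closed_gens_def by simp
  moreover have "(\<lambda>x. a (x, []) * b (x, [])) \<in> fm.span (set (monomials (D + D')))"
    "\<forall>d<k. (\<lambda>y. a (snoc d y) * b (snoc d y)) \<in> fm.span ?U" if "a \<in> S" "b \<in> T" for a b
    using closed_gens_span[OF S(1) fm.span_base[OF that(1)]]
      closed_gens_span[OF T(1) fm.span_base[OF that(2)]]
    by (auto intro: monomials_mult span_mult)
  ultimately have "closed_gens k (D + D') ?U" unfolding closed_gens_def by blast
  then show ?thesis
    unfolding regular_def using span_mult[OF S(2) T(2)] by blast
qed

lemma regular_power2: "regular k D f \<Longrightarrow> regular k (D + D) (\<lambda>y. (f y)\<^sup>2)"
  using regular_mult[of k D f D f] by (simp add: power2_eq_square)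

text \<open>One extra generator, \<open>f\<close> itself, is enough. This turns a defect per step
  into the total penalty of a run.\<close>

lemma regular_accumulate:
  assumes "regular k D h" "\<And>x. f (x, []) = 0" "\<And>d y. d < k \<Longrightarrow> f (snoc d y) = f y + h y"
  shows "regular k D f"
proof -
  from assms(1) obtain S where S: "closed_gens k D S" "h \<in> fm.span S"
    unfolding regular_def by blast
  have sub: "fm.span S \<subseteq> fm.span (insert f S)" by (intro fm.span_mono) auto
  have f: "f \<in> fm.span (insert f S)" by (rule fm.span_base) simp
  have "(\<lambda>y. f (snoc d y)) \<in> fm.span (insert f S)" if "d < k" for d
    using span_addI[OF f subsetD[OF sub S(2)]] assms(3)[OF that] by simp
  then have "closed_gens k D (insert f S)"
    using S(1) sub assms(2) span_zeroI unfolding closed_gens_def by auto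
  with f show ?thesis unfolding regular_def by blast
qed

lemma regular_tl:
  assumes "regular k D f"
  shows "regular k D (\<lambda>y. f (fst y, tl (snd y)))"
proof -
  from assms obtain S where S: "closed_gens k D S" "f \<in> fm.span S"
    unfolding regular_def by blast
  define A where "A g y = g (fst y, tl (snd y))" for g :: family and y
  \<comment> \<open>Dropping the first digit commutes with appending one except on the empty string.
    \<open>B g\<close> isolates that exceptional case and vanishes once a digit has been
    read.\<close>
  define B where "B g y = of_bool (snd y = []) * A g y" for g :: family and y
  let ?T = "A ` S \<union> B ` S"
  have A: "A g \<in> fm.span ?T" if "g \<in> fm.span S" for g
    using span_comp[OF that, of "\<lambda>y. (fst y, tl (snd y))" ?T]
    by (auto simp: A_def[abs_def] intro: fm.span_base)
  have B: "B g \<in> fm.span ?T" if "g \<in> fm.span S" for g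
    using span_pullback[OF that, of "\<lambda>y. of_bool (snd y = [])" "\<lambda>y. (fst y, tl (snd y))" ?T]
    by (auto simp: A_def[abs_def] B_def[abs_def] intro: fm.span_base)
  have "closed_gens k D ?T"
    unfolding closed_gens_def
  proof (intro conjI ballI allI impI)
    show "finite ?T" using S(1) by (simp add: closed_gens_def)
    fix g' assume "g' \<in> ?T"
    then obtain g where g: "g \<in> S" and g': "g' = A g \<or> g' = B g" by auto
    have init: "(\<lambda>x. g (x, [])) \<in> fm.span (set (monomials D))" "\<And>d. d < k \<Longrightarrow> (\<lambda>y. g (snoc d y)) \<in> fm.span S"
      using S(1) g unfolding closed_gens_def by auto
    from g' init(1) show "(\<lambda>x. g' (x, [])) \<in> fm.span (set (monomials D))"
      by (auto simp: A_def B_def)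
    fix d assume d: "d < k"
    from g' show "(\<lambda>y. g' (snoc d y)) \<in> fm.span ?T"
    proof
      assume "g' = A g"
      then have "g' (snoc d y) = (B g y + - 1 * B (\<lambda>y. g (snoc d y)) y) + A (\<lambda>y. g (snoc d y)) y" for y
        by (cases "snd y") (auto simp: A_def B_def snoc_def)
      moreover have "(\<lambda>y. (B g y + - 1 * B (\<lambda>y. g (snoc d y)) y) + A (\<lambda>y. g (snoc d y)) y) \<in> fm.span ?T"
        by (intro span_addI A B span_scaleI init(2)[OF d] fm.span_base g)
      ultimately show ?thesis by simp
    next
      assume "g' = B g"
      then have "(\<lambda>y. g' (snoc d y)) = (\<lambda>y. 0)" by (auto simp: B_def snoc_def)
      then show ?thesis using span_zeroI by simp
    qed
  qed
  moreover have "A f \<in> fm.span ?T" using A S(2) by blast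
  ultimately show ?thesis unfolding regular_def A_def[abs_def] by blast
qed

lemma regular_drop: "regular k D f \<Longrightarrow> regular k D (\<lambda>y. f (fst y, drop e (snd y)))"
proof (induction e)
  case (Suc e)
  from regular_tl[OF Suc.IH[OF Suc.prems]] show ?case by (simp add: drop_Suc)
qed simp

fun digit_value :: "nat \<Rightarrow> nat list \<Rightarrow> nat" where
  "digit_value k [] = 0"
| "digit_value k (d # ds) = d + k * digit_value k ds"

lemma digit_value_snoc: "digit_value k (ds @ [d]) = digit_value k ds + d * k ^ length ds"
  by (induction ds) (auto simp: algebra_simps)

text \<open>A new digit \<open>d\<close> adds \<open>d\<close> times the current power of the base,
  so that power is taken as a second generator.\<close>

lemma regular_digit_value: "regular k D (\<lambda>y. int (digit_value k (snd y)))"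
proof -
  let ?f = "\<lambda>y :: (nat \<times> nat) \<times> nat list. int (digit_value k (snd y))"
  let ?g = "\<lambda>y :: (nat \<times> nat) \<times> nat list. int (k ^ length (snd y))"
  have f: "?f \<in> fm.span {?f, ?g}" and g: "?g \<in> fm.span {?f, ?g}"
    by (auto intro: fm.span_base)
  have one: "(\<lambda>x. 1) \<in> fm.span (set (monomials D))"
    using monomial_in_span[of 0 D 0] by simp
  have "(\<lambda>y. ?f (snoc d y)) \<in> fm.span {?f, ?g}" for d
    using span_addI[OF f span_scaleI[OF g, of "int d"]] by (simp add: snoc_def digit_value_snoc)
  moreover have "(\<lambda>y. ?g (snoc d y)) \<in> fm.span {?f, ?g}" for d
    using span_scaleI[OF g, of "int k"] by (simp add: snoc_def)
  ultimately have "closed_gens k D {?f, ?g}"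
    unfolding closed_gens_def using one span_zeroI by simp
  with f show ?thesis unfolding regular_def by blast
qed

section \<open>From closed generators to linear representations\<close>

declare digits.simps [simp del]

lemma digits_less: "k \<ge> 2 \<Longrightarrow> d \<in> set (digits k n) \<Longrightarrow> d < k"
proof (induction k n rule: digits.induct)
  case (1 k n)
  then show ?case by (auto split: if_splits simp: digits.simps[of k n])
qed

text \<open>Moving the initial values into new generators that vanish after the first digit turns the row
  vector into the list of monomials followed by zeros. Apart from the number of zeros it is then
  the same for all families, which is what allows a family to refer to its own code.\<close>

lemma regular_normal_form:
  assumes "regular k D f"
  obtains fs where "f \<in> fm.span (set (map (\<lambda>m y. if snd y = [] then m (fst y) else 0) (monomials D) @ fs))"
    and "\<And>g x. g \<in> set fs \<Longrightarrow> g (x, []) = 0"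
    and "\<And>g d. g \<in> set (map (\<lambda>m y. if snd y = [] then m (fst y) else 0) (monomials D) @ fs) \<Longrightarrow> d < k \<Longrightarrow>
      (\<lambda>y. g (snoc d y)) \<in> fm.span (set (map (\<lambda>m y. if snd y = [] then m (fst y) else 0) (monomials D) @ fs))"
proof -
  from assms obtain S where S: "closed_gens k D S" "f \<in> fm.span S"
    unfolding regular_def by blast
  then obtain gs where gs: "set gs = S" unfolding closed_gens_def using finite_list by blast
  let ?E = "map (\<lambda>m (y :: (nat \<times> nat) \<times> nat list). if snd y = [] then m (fst y) else 0) (monomials D)"
  let ?fs = "map (\<lambda>g (y :: (nat \<times> nat) \<times> nat list). if snd y = [] then 0 else g y :: int) gs"
  have "g \<in> fm.span (set (?E @ ?fs))" if "g \<in> S" for g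
  proof -
    have "(\<lambda>x. g (x, [])) \<in> fm.span (set (monomials D))"
      using S(1) that unfolding closed_gens_def by blast
    \<comment> \<open>Each generator is split into its value at the empty string, a combination of
      monomials, and its restriction to nonempty strings.\<close>
    then have "(\<lambda>y. of_bool (snd y = []) * g (fst y, [])) \<in> fm.span (set (?E @ ?fs))"
      by (rule span_pullback[where h = fst]) (auto intro!: fm.span_base simp: image_iff fun_eq_iff)
    moreover have "(\<lambda>y. if snd y = [] then 0 else g y) \<in> fm.span (set (?E @ ?fs))"
      using that gs by (intro fm.span_base) auto
    ultimately have "(\<lambda>y. of_bool (snd y = []) * g (fst y, []) + (if snd y = [] then 0 else g y)) \<in> fm.span (set (?E @ ?fs))"
      by (rule span_addI)
    moreover have "of_bool (snd y = []) * g (fst y, []) + (if snd y = [] then 0 else g y) = g y" for y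
      by (cases y) auto
    ultimately show ?thesis by simp
  qed
  then have span: "g \<in> fm.span (set (?E @ ?fs))" if "g \<in> fm.span S" for g
    using span_subset[OF _ that] by blast
  show thesis
  proof
    show "f \<in> fm.span (set (?E @ ?fs))" using span S(2) by blast
    show "g (x, []) = 0" if "g \<in> set ?fs" for g x using that by auto
    show "(\<lambda>y. g (snoc d y)) \<in> fm.span (set (?E @ ?fs))" if "g \<in> set (?E @ ?fs)" "d < k" for g d
    proof (cases "g \<in> set ?E")
      case True
      then have "(\<lambda>y. g (snoc d y)) = (\<lambda>y. 0)" by (auto simp: snoc_def)
      then show ?thesis using span_zeroI by simp
    next
      case False
      with that(1) obtain h where "h \<in> S" "g = (\<lambda>y. if snd y = [] then 0 else h y)" using gs by auto
      then have "(\<lambda>y. g (snoc d y)) = (\<lambda>y. h (snoc d y))" "(\<lambda>y. h (snoc d y)) \<in> fm.span S"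
        using S(1) that(2) unfolding closed_gens_def by (auto simp: snoc_def)
      then show ?thesis using span by simp
    qed
  qed
qed

text \<open>The row vector after reading a string lists the values of the generators there; column
  \<open>j\<close> of a matrix holds the transition coefficients of generator \<open>j\<close>, and
  \<open>w\<close> the coefficients of \<open>f\<close>. Only the row vector depends on the
  parameters.\<close>

lemma regular_linrep:
  assumes "regular k D f" "k \<ge> 2"
  obtains r w Ms where
    "\<And>x. wf_linrep k (map (\<lambda>m. m x) (monomials D) @ replicate r 0, w, Ms)"
    "\<And>x n. linrep_seq k (map (\<lambda>m. m x) (monomials D) @ replicate r 0, w, Ms) n = f (x, digits k n)"
proof -
  let ?E = "map (\<lambda>m (y :: (nat \<times> nat) \<times> nat list). if snd y = [] then m (fst y) else 0) (monomials D)"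
  from assms(1) obtain gs where f: "f \<in> fm.span (set (?E @ gs))"
    and init: "\<And>g x. g \<in> set gs \<Longrightarrow> g (x, []) = 0"
    and closed: "\<And>g d. g \<in> set (?E @ gs) \<Longrightarrow> d < k \<Longrightarrow> (\<lambda>y. g (snoc d y)) \<in> fm.span (set (?E @ gs))"
    by (rule regular_normal_form) blast
  define fs where "fs = ?E @ gs"
  let ?n = "length fs"
  obtain c where c: "\<And>y. f y = (\<Sum>i<?n. c i * (fs ! i) y)"
    using span_list[OF f] unfolding fs_def by blast
  have "\<exists>e. \<forall>y. (fs ! j) (snoc d y) = (\<Sum>i<?n. e i * (fs ! i) y)" if "j < ?n" "d < k" for j d
    using span_list[OF closed[folded fs_def, OF nth_mem[OF that(1)] that(2)]] .
  then obtain C where C: "\<And>j d y. j < ?n \<Longrightarrow> d < k \<Longrightarrow> (fs ! j) (snoc d y) = (\<Sum>i<?n. C j d i * (fs ! i) y)"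
    by metis
  let ?w = "map c [0..<?n]"
  let ?Ms = "map (\<lambda>d. map (\<lambda>i. map (\<lambda>j. C j d i) [0..<?n]) [0..<?n]) [0..<k]"
  let ?v = "\<lambda>x. map (\<lambda>m. m x) (monomials D) @ replicate (length gs) 0"
  have len: "length (?v x) = ?n" for x
    by (simp add: fs_def)
  have "map (\<lambda>g. g (x, [])) gs = replicate (length gs) 0" for x
    by (rule nth_equalityI) (simp_all add: init)
  then have v: "?v x = map (\<lambda>g. g (x, [])) fs" for x
    by (simp add: fs_def)
  have fold: "foldl (\<lambda>u d. vecmat ?n u (?Ms ! d)) (?v x) ds = map (\<lambda>g. g (x, ds)) fs"
    if "\<forall>d \<in> set ds. d < k" for x ds
    using that
  proof (induction ds rule: rev_induct)
    case Nil
    show ?case using v by simp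
  next
    case (snoc d ds)
    then have d: "d < k" by simp
    have "(\<Sum>i<?n. map (\<lambda>g. g (x, ds)) fs ! i * (?Ms ! d) ! i ! j) = (fs ! j) (x, ds @ [d])" if "j < ?n" for j
      using C[OF that d, of "(x, ds)"] that d by (simp add: snoc_def mult.commute)
    then show ?case
      using snoc by (auto simp: vecmat_def intro!: nth_equalityI)
  qed
  show thesis
  proof
    show "wf_linrep k (?v x, ?w, ?Ms)" for x
      by (auto simp: wf_linrep_def fs_def)
    show "linrep_seq k (?v x, ?w, ?Ms) n = f (x, digits k n)" for x n
      using fold[of "digits k n" x] digits_less[OF assms(2)] len[of x]
      by (simp add: linrep_seq_def dotp_def c mult.commute)
  qed
qed

section \<open>The penalty of a run as a regular sequence\<close>

fun regs :: "instr \<Rightarrow> nat set" where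
  "regs (Asg i b j c) = {i, j}"
| "regs (Test i j) = {i, j}"

definition input :: "nat \<times> nat \<Rightarrow> nat \<Rightarrow> nat" where
  "input x i = (if i = 0 then fst x else if i = 1 then snd x else 0)"

text \<open>The index \<open>R\<close> stands for the constant 1, which makes affine assignments
  linear.\<close>

definition entry :: "nat \<Rightarrow> (nat \<Rightarrow> nat) \<Rightarrow> nat \<Rightarrow> int" where
  "entry R s i = (if i < R then int (s i) else 1)"

definition cfg :: "prog \<Rightarrow> (nat \<times> nat) \<times> nat list \<Rightarrow> config" where
  "cfg P y = reads P (input (fst y)) (snd y)"

text \<open>A register value times the indicator of a location: since the update depends on the
  location, only these products evolve linearly.\<close>

definition gen :: "prog \<Rightarrow> nat \<Rightarrow> nat \<Rightarrow> nat \<Rightarrow> family" where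
  "gen P R l i y = (if fst (cfg P y) = l then entry R (fst (snd (cfg P y))) i else 0)"

lemma cfg_snoc: "cfg P (snoc d y) = move (code P 0) (cfg P y) d"
  by (simp add: cfg_def snoc_def reads_def)

lemma target_le: "l \<le> length (code P 0) \<Longrightarrow> target (code P 0) l d \<le> length (code P 0)"
proof (cases "l < length (code P 0)")
  case True
  obtain a x y where "code P 0 ! l = (a, x, y)" by (cases "code P 0 ! l") auto
  with True code_target[of a x y P 0] nth_mem[OF True] show ?thesis
    by (simp add: target_def node_def)
qed (simp add: target_def node_def)

lemma cfg_loc_le: "fst (cfg P (x, ds)) \<le> length (code P 0)"
proof (induction ds rule: rev_induct)
  case Nil
  show ?case by (simp add: cfg_def reads_def)
next
  case (snoc d ds)
  show ?case
    using cfg_snoc[of P d "(x, ds)"] target_le[OF snoc] by (cases "cfg P (x, ds)") (simp add: snoc_def)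
qed

lemma entry_exec:
  assumes "regs a \<subseteq> {..<R}" "i \<le> R"
  shows "\<exists>b j c. j \<le> R \<and> (\<forall>s. entry R (exec a s) i = b * entry R s j + c * entry R s R)"
proof (cases a)
  case (Asg i' b j c)
  show ?thesis
  proof (cases "i = i'")
    case True
    with Asg assms show ?thesis
      by (intro exI[of _ "int b"] exI[of _ j] exI[of _ "int c"]) (auto simp: entry_def)
  next
    case False
    with Asg assms show ?thesis
      by (intro exI[of _ 1] exI[of _ i] exI[of _ 0]) (auto simp: entry_def)
  qed
next
  case (Test j j')
  with assms show ?thesis
    by (intro exI[of _ 1] exI[of _ i] exI[of _ 0]) auto
qed

lemma regular_gen:
  assumes R: "\<And>l. regs (action (code P 0) l) \<subseteq> {..<R}" and li: "l \<le> length (code P 0)" "i \<le> R"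
  shows "regular k 1 (gen P R l i)"
proof -
  let ?L = "length (code P 0)"
  let ?S = "(\<lambda>(l, i). gen P R l i) ` ({..?L} \<times> {..R})"
  have base: "gen P R l i \<in> fm.span ?S" if "l \<le> ?L" "i \<le> R" for l i
    by (rule fm.span_base) (use that in auto)
  have init: "(\<lambda>x. gen P R l i (x, [])) \<in> fm.span (set (monomials 1))" if "i \<le> R" for l i
  proof -
    have e: "entry R (input x) i = (if i < R then if i = 0 then int (fst x ^ 1 * snd x ^ 0) else if i = 1 then int (fst x ^ 0 * snd x ^ 1) else 0
        else int (fst x ^ 0 * snd x ^ 0))" for x
      by (simp add: entry_def input_def)
    have "(\<lambda>x. entry R (input x) i) \<in> fm.span (set (monomials 1))"
      unfolding e using monomial_in_span[of 1 1 0] monomial_in_span[of 0 1 1] monomial_in_span[of 0 1 0] span_zeroI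
      by (cases "i < R"; cases "i = 0"; cases "i = 1") simp_all
    then show ?thesis
      using span_zeroI by (cases "l = 0") (simp_all add: gen_def cfg_def reads_def)
  qed
  have step: "(\<lambda>y. gen P R l i (snoc d y)) \<in> fm.span ?S" if "i \<le> R" for l i d
  proof -
    \<comment> \<open>The locations from which digit \<open>d\<close> leads to \<open>l\<close>. The
      value after the digit is the sum over these predecessors, where at most the current location
      contributes.\<close>
    let ?M = "{m. m \<le> ?L \<and> target (code P 0) m d = l}"
    define g where "g m y = (if fst (cfg P y) = m then entry R (exec (action (code P 0) m) (fst (snd (cfg P y)))) i else 0)" for m y
    have "g m \<in> fm.span ?S" if "m \<le> ?L" for m
    proof -
      obtain b j c where "j \<le> R" and e: "\<And>s. entry R (exec (action (code P 0) m) s) i = b * entry R s j + c * entry R s R"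
        using entry_exec[OF R \<open>i \<le> R\<close>] by blast
      then have "(\<lambda>y. b * gen P R m j y + c * gen P R m R y) \<in> fm.span ?S"
        using that by (intro span_addI span_scaleI base) auto
      moreover have "g m = (\<lambda>y. b * gen P R m j y + c * gen P R m R y)"
        by (auto simp: g_def gen_def e)
      ultimately show ?thesis by simp
    qed
    then have "(\<lambda>y. \<Sum>m \<in> ?M. g m y) \<in> fm.span ?S"
      by (intro span_sumI) auto
    moreover have "gen P R l i (snoc d y) = (\<Sum>m \<in> ?M. g m y)" for y
    proof -
      obtain m s p where c: "cfg P y = (m, s, p)" by (cases "cfg P y") auto
      have "m \<le> ?L" using cfg_loc_le[of P "fst y" "snd y"] c by simp
      then have "(\<Sum>m \<in> ?M. g m y) = (if target (code P 0) m d = l then entry R (exec (action (code P 0) m) s) i else 0)"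
        by (simp add: g_def c sum.delta)
      then show ?thesis by (simp add: gen_def cfg_snoc c)
    qed
    ultimately show ?thesis by simp
  qed
  have "closed_gens k 1 ?S"
    unfolding closed_gens_def using init step by auto
  with base[OF li] show ?thesis unfolding regular_def by blast
qed

text \<open>The extra 1 punishes stopping before the exit, so zeros are exactly the accepting
  runs.\<close>

definition penalty :: "prog \<Rightarrow> family" where
  "penalty P y = snd (snd (cfg P y)) + of_bool (fst (cfg P y) \<noteq> length (code P 0))"

lemma penalty_nonneg: "penalty P y \<ge> 0"
  using run_penalty_mono[of "(0, input (fst y), 0)" "code P 0" "snd y"]
  by (simp add: penalty_def cfg_def reads_def)

lemma penalty_eq_0: "penalty P y = 0 \<longleftrightarrow> (\<exists>t. cfg P y = (length (code P 0), t, 0))"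
  using run_penalty_mono[of "(0, input (fst y), 0)" "code P 0" "snd y"]
  by (cases "cfg P y") (auto simp: penalty_def cfg_def reads_def)

text \<open>The exit is absorbing, so an accepting string may be prolonged. This allows a final
  digit 1, as number representations require a nonzero leading digit.\<close>

lemma penalty_snoc: "penalty P y = 0 \<Longrightarrow> penalty P (snoc d y) = 0"
  by (auto simp: penalty_eq_0 cfg_snoc target_def action_def node_def)

lemma regular_penalty: "regular k 2 (penalty P)"
proof -
  let ?N = "code P 0"
  let ?L = "length ?N"
  have "finite (\<Union>n \<in> set ?N. regs (fst n))"
    by (auto, case_tac a) auto
  then obtain R0 where R0: "(\<Union>n \<in> set ?N. regs (fst n)) \<subseteq> {..<R0}"
    unfolding finite_nat_set_iff_bounded by blast
  \<comment> \<open>The successor ensures that register 0, which the no-op \<open>Test 0 0\<close>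
    mentions, is also below \<open>R\<close>.\<close>
  define R where "R = Suc R0"
  have R: "regs (action ?N l) \<subseteq> {..<R}" for l
  proof (cases "l < ?L")
    case True
    then have "?N ! l \<in> set ?N" by simp
    with R0 True show ?thesis by (fastforce simp: R_def action_def node_def)
  qed (simp add: action_def node_def R_def)
  note gen = regular_gen[OF R]
  define h where "h y = defect (action ?N (fst (cfg P y))) (fst (snd (cfg P y)))" for y
  have "regular k 2 (\<lambda>y. if fst (cfg P y) = l then defect (action ?N l) (fst (snd (cfg P y))) else 0)" if "l \<le> ?L" for l
  proof (cases "action ?N l")
    case (Test i j)
    then have ij: "i < R" "j < R" using R[of l] by auto
    then have "regular k (1 + 1) (\<lambda>y. (gen P R l i y - gen P R l j y)\<^sup>2)"
      using that by (intro regular_power2 regular_diff gen) auto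
    moreover have "(gen P R l i y - gen P R l j y)\<^sup>2 =
        (if fst (cfg P y) = l then defect (action ?N l) (fst (snd (cfg P y))) else 0)" for y
      using ij by (simp add: Test gen_def entry_def)
    ultimately show ?thesis by (simp add: numeral_2_eq_2)
  qed (simp add: regular_const cong: if_cong)
  then have "regular k 2 (\<lambda>y. \<Sum>l\<le>?L. if fst (cfg P y) = l then defect (action ?N l) (fst (snd (cfg P y))) else 0)"
    by (intro regular_sum) auto
  moreover have "(\<Sum>l\<le>?L. if fst (cfg P y) = l then defect (action ?N l) (fst (snd (cfg P y))) else 0) = h y" for y
    using cfg_loc_le[of P "fst y" "snd y"] by (simp add: h_def)
  ultimately have "regular k 2 h" by simp
  then have "regular k 2 (\<lambda>y. snd (snd (cfg P y)))"
  proof (rule regular_accumulate)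
    show "snd (snd (cfg P (x, []))) = 0" for x by (simp add: cfg_def reads_def)
    show "snd (snd (cfg P (snoc d y))) = snd (snd (cfg P y)) + h y" for d y
      by (cases "cfg P y") (simp add: cfg_snoc h_def)
  qed
  \<comment> \<open>With the constant index \<open>R\<close>, the generator at the exit is the
    indicator of having arrived there.\<close>
  moreover have "regular k 2 (\<lambda>y. 1 + - 1 * gen P R ?L R y)"
    by (intro regular_add regular_const regular_scale regular_mono[OF gen]) auto
  ultimately have "regular k 2 (\<lambda>y. snd (snd (cfg P y)) + (1 + - 1 * gen P R ?L R y))"
    by (rule regular_add)
  moreover have "snd (snd (cfg P y)) + (1 + - 1 * gen P R ?L R y) = penalty P y" for y
    by (simp add: penalty_def gen_def entry_def)
  ultimately show ?thesis by simp
qed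

section \<open>Reduction from acceptance of a program to the existence of powers\<close>

text \<open>For $a > 0$ and $n \<ge> 0$ the value lies between the squares of $a(n+1)$ and $a(n+1) + 1$, so it
  determines $a(n+1)$ and $an$, hence $n$; for $a = 0$ it is 0.\<close>

definition spread :: "int \<Rightarrow> int \<Rightarrow> int" where
  "spread a n = (a * (n + 1))\<^sup>2 + a * n"

lemma spread_inj:
  assumes "a > 0" "a' > 0" "n \<ge> 0" "n' \<ge> 0" "spread a n = spread a' n'"
  shows "n = n'"
proof -
  \<comment> \<open>Excluding one strict order for all arguments suffices, since exchanging the two
    pairs excludes the other.\<close>
  have "\<not> a * (n + 1) < a' * (n' + 1)"
    if "a > 0" "a' > 0" "n \<ge> 0" "n' \<ge> 0" "spread a n = spread a' n'" for a a' n n'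
  proof
    let ?x = "a * (n + 1)"
    let ?x' = "a' * (n' + 1)"
    assume "?x < ?x'"
    moreover have "?x \<ge> 0" using that by simp
    ultimately have "(?x + 1)\<^sup>2 \<le> ?x'\<^sup>2" by (intro power_mono) auto
    moreover have "spread a n < (?x + 1)\<^sup>2"
    proof -
      have "(?x + 1)\<^sup>2 = ?x\<^sup>2 + 2 * ?x + 1" "?x = a * n + a"
        by (simp_all add: power2_eq_square algebra_simps)
      moreover have "0 \<le> a * n" using that by simp
      ultimately show ?thesis using that(1) unfolding spread_def by linarith
    qed
    moreover have "?x'\<^sup>2 \<le> spread a' n'"
      using that by (simp add: spread_def)
    ultimately show False using that(5) by linarith
  qed
  from this[of a a' n n'] this[of a' a n' n] assms have x: "a * (n + 1) = a' * (n' + 1)" by force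
  with assms(5) have "a * n = a' * n'" by (simp add: spread_def)
  with x have "a = a'" by (simp add: algebra_simps)
  with \<open>a * n = a' * n'\<close> assms(1) show ?thesis by simp
qed

lemma digit_value_digits: "k \<ge> 2 \<Longrightarrow> digit_value k (digits k n) = n"
proof (induction k n rule: digits.induct)
  case (1 k n)
  then show ?case
    by (cases "n = 0") (auto simp: digits.simps[of k n] digits.simps[of k 0])
qed

lemma drop_digits: "k \<ge> 2 \<Longrightarrow> drop e (digits k n) = digits k (n div k ^ e)"
proof (induction e arbitrary: n)
  case (Suc e)
  have "drop (Suc e) (digits k n) = drop e (digits k (n div k))"
    by (subst digits.simps) (use Suc.prems in \<open>auto simp: digits.simps[of k 0]\<close>)
  then show ?case using Suc by (simp add: div_mult2_eq)
qed simp

lemma digits_surj: "k \<ge> 2 \<Longrightarrow> set ds \<subseteq> {0, 1} \<Longrightarrow> \<exists>n>0. digits k n = ds @ [1]"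
proof (induction ds)
  case Nil
  then show ?case by (intro exI[of _ 1]) (simp add: digits.simps[of k "Suc 0"] digits.simps[of k 0])
next
  case (Cons d ds)
  then obtain n where n: "n > 0" "digits k n = ds @ [1]" by auto
  have "d < k" using Cons.prems by auto
  then have "digits k (d + k * n) = d # ds @ [1]"
    using n Cons.prems(1) by (subst digits.simps) (simp)
  with n Cons.prems(1) show ?case by (intro exI[of _ "d + k * n"]) auto
qed

text \<open>The number of zeros, the column vector and the matrices are fixed by \<open>q\<close>,
  the base and \<alpha>; the input enters through the monomials alone.\<close>

lemma power_reduction:
  assumes k: "k \<ge> 2" and \<alpha>: "\<alpha> \<ge> 2"
  obtains r w Ms where
    "\<And>x. wf_linrep k (map (\<lambda>m. m x) (monomials 4) @ replicate r 0, w, Ms)"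
    "\<And>x. has_power (linrep_seq k (map (\<lambda>m. m x) (monomials 4) @ replicate r 0, w, Ms)) \<alpha> \<longleftrightarrow>
      reval q [fst x, snd x] 0"
proof -
  obtain P where P: "\<And>s. (\<exists>t. (s, t) \<in> sem P) \<longleftrightarrow> reval q [s 0, s 1] 0"
    using accepting_program by blast
  have accept: "(\<exists>n. penalty P (x, digits k n) = 0) \<longleftrightarrow> reval q [fst x, snd x] 0" for x
  proof
    assume "\<exists>n. penalty P (x, digits k n) = 0"
    then obtain n t where "reads P (input x) (digits k n) = (length (code P 0), t, 0)"
      by (auto simp: penalty_eq_0 cfg_def)
    from P[of "input x"] reads_sem[OF this] show "reval q [fst x, snd x] 0"
      by (auto simp: input_def)
  next
    assume "reval q [fst x, snd x] 0"
    then obtain t where "(input x, t) \<in> sem P" using P[of "input x"] by (auto simp: input_def)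
    from sem_reads[OF this] obtain ds where ds: "set ds \<subseteq> {0, 1}" "penalty P (x, ds) = 0"
      by (auto simp: penalty_eq_0 cfg_def)
    then obtain n where "digits k n = ds @ [1]" using digits_surj[OF k] by blast
    with penalty_snoc[OF ds(2), of 1] have "penalty P (x, digits k n) = 0" by (simp add: snoc_def)
    then show "\<exists>n. penalty P (x, digits k n) = 0" ..
  qed
  \<comment> \<open>Skipping the $\<alpha>$ lowest digits repeats each zero of the penalty $k^\<alpha>$ times in a row.\<close>
  define a where "a = (\<lambda>y. penalty P (fst y, drop \<alpha> (snd y)))"
  define f where "f = (\<lambda>y. spread (a y) (int (digit_value k (snd y))))"
  have a: "regular k 2 a"
    unfolding a_def by (rule regular_drop[OF regular_penalty])
  have "regular k 2 (\<lambda>y. a y * (int (digit_value k (snd y)) + 1))" "regular k 2 (\<lambda>y. a y * int (digit_value k (snd y)))"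
    using regular_mult[OF a regular_add[OF regular_digit_value regular_const], of 0 1]
      regular_mult[OF a regular_digit_value, of 0] by simp_all
  \<comment> \<open>The penalty has degree 2 in the parameters, the digit value degree 0; squaring
    gives the bound 4.\<close>
  from regular_add[OF regular_power2[OF this(1)] regular_mono[OF this(2)]]
  have "regular k 4 f" unfolding f_def spread_def by simp
  from this k obtain r w Ms where
    wf: "\<And>x. wf_linrep k (map (\<lambda>m. m x) (monomials 4) @ replicate r 0, w, Ms)" and
    eq: "\<And>x n. linrep_seq k (map (\<lambda>m. m x) (monomials 4) @ replicate r 0, w, Ms) n = f (x, digits k n)"
    by (rule regular_linrep) blast
  have val: "f (x, digits k n) = spread (penalty P (x, digits k (n div k ^ \<alpha>))) (int n)" for x n
    unfolding f_def a_def using drop_digits[OF k] digit_value_digits[OF k] by simp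
  show thesis
  proof
    fix x
    let ?F = "linrep_seq k (map (\<lambda>m. m x) (monomials 4) @ replicate r 0, w, Ms)"
    have F: "?F n = spread (penalty P (x, digits k (n div k ^ \<alpha>))) (int n)" for n
      using eq val by simp
    show "has_power ?F \<alpha> \<longleftrightarrow> reval q [fst x, snd x] 0"
    proof
      assume "has_power ?F \<alpha>"
      then obtain i m where m: "m \<ge> 1" and p: "\<And>s t. s < \<alpha> \<Longrightarrow> t < m \<Longrightarrow> ?F (i + t) = ?F (i + s * m + t)"
        unfolding has_power_def by blast
      \<comment> \<open>Two blocks already give equal values at the distinct positions
        \<open>i\<close> and \<open>i + m\<close>, which \<open>spread_inj\<close> forbids if both
        penalties are positive.\<close>
      from p[of 1 0] m \<alpha> have "?F i = ?F (i + m)" by simp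
      then have "\<not> (penalty P (x, digits k (i div k ^ \<alpha>)) > 0 \<and> penalty P (x, digits k ((i + m) div k ^ \<alpha>)) > 0)"
        using spread_inj[of _ _ "int i" "int (i + m)"] m unfolding F by fastforce
      then have "\<exists>n. penalty P (x, digits k n) = 0"
        using penalty_nonneg by (metis order_le_less)
      then show "reval q [fst x, snd x] 0" using accept by blast
    next
      assume "reval q [fst x, snd x] 0"
      then obtain n where n: "penalty P (x, digits k n) = 0" using accept by blast
      \<comment> \<open>These positions share the number \<open>n\<close> as their quotient, because
        \<alpha> is below \<open>k ^ \<alpha>\<close>; the zeros form a power with period 1.\<close>
      have "?F (n * k ^ \<alpha> + s) = 0" if "s < \<alpha>" for s
      proof -
        have "s < k ^ \<alpha>" using that k less_exp[of \<alpha>] power_mono[of 2 k \<alpha>] by linarith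
        then have "(n * k ^ \<alpha> + s) div k ^ \<alpha> = n" using k by simp
        then show ?thesis unfolding F by (simp add: n spread_def)
      qed
      from this this[of 0] have "\<forall>s<\<alpha>. \<forall>t<1. ?F (n * k ^ \<alpha> + t) = ?F (n * k ^ \<alpha> + s * 1 + t)"
        using \<alpha> by simp
      then show "has_power ?F \<alpha>" unfolding has_power_def by blast
    qed
  qed (rule wf)
qed

section \<open>Diagonalisation\<close>

lemma int_encode_nat: "int_encode (int n) = n + n"
  by (simp add: int_encode_def sum_encode_def)

text \<open>\<open>list_encode\<close> is built from the front by \<open>prod_encode\<close>, so
  elements can be put before the list with code \<open>x\<close> without decoding \<open>x\<close>.
  The doubling is \<open>int_encode\<close> on nonnegative integers.\<close>

lemma computable2_enc_append:
  assumes "\<forall>f \<in> set fs. computable2 f"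
  shows "computable2 (\<lambda>x y. list_encode (map (\<lambda>f. f x y + f x y) fs @ list_decode x))"
  using assms
proof (induction fs)
  case Nil
  show ?case by (simp add: computable2_fst)
next
  case (Cons f fs)
  then show ?case
    by (auto intro!: computable2_Suc computable2_comp[OF computable2_prod_encode]
        computable2_comp[OF computable2_add])
qed

text \<open>Here \<open>x\<close> is meant as the code of the zeros that end the row vector and
  \<open>y\<close> as the code of the column vector and the matrices, so the value is the code of a
  whole instance.\<close>

lemma computable2_code:
  "computable2 (\<lambda>x y. prod_encode
     (list_encode (map int_encode (map (\<lambda>m. m (x, y)) (monomials D)) @ list_decode x), y))"
proof -
  let ?fs = "map (\<lambda>(i, j) x y. x ^ i * y ^ j) (List.product [0..<Suc D] [0..<Suc D])"
  have "\<forall>f \<in> set ?fs. computable2 f"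
    by (auto intro!: computable2_comp[OF computable2_mult] computable2_power computable2_fst computable2_snd)
  from computable2_enc_append[OF this]
  have "computable2 (\<lambda>x y. prod_encode (list_encode (map (\<lambda>f. f x y + f x y) ?fs @ list_decode x), y))"
    by (intro computable2_comp[OF computable2_prod_encode] computable2_snd)
  moreover have "map int_encode (map (\<lambda>m. m (x, y)) (monomials D)) = map (\<lambda>f. f x y + f x y) ?fs" for x y
    by (auto simp: monomials_def int_encode_nat simp del: of_nat_mult of_nat_power upt_Suc)
  ultimately show ?thesis by simp
qed

lemma inj_enc_intlist: "inj enc_intlist"
  by (rule injI) (auto simp: enc_intlist_def list_encode_eq inj_map_eq_map int_encode_eq inj_def)

lemma inj_enc_mat: "inj enc_mat"
  by (rule injI) (auto simp: enc_mat_def list_encode_eq inj_map_eq_map[OF inj_enc_intlist])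

text \<open>Needed because \<open>power_problem\<close> only asks for some representation with the
  given code.\<close>

lemma enc_linrep_inj: "enc_linrep R = enc_linrep R' \<Longrightarrow> R = R'"
  by (auto simp: enc_linrep_def list_encode_eq prod_encode_eq inj_eq[OF inj_enc_intlist]
      inj_map_eq_map[OF inj_enc_mat] split: prod.splits)

theorem theorem5p1:
  fixes k \<alpha> :: nat
  assumes "k \<ge> 2" and "\<alpha> \<ge> 2"
  shows "\<not> recursive_set (power_problem k \<alpha>)"
proof
  assume "recursive_set (power_problem k \<alpha>)"
  then obtain p where p: "\<And>n. reval p [n] (if n \<in> power_problem k \<alpha> then 1 else 0)"
    unfolding recursive_set_def by blast
  obtain g where g: "\<And>x y. reval g [x, y] (prod_encode
      (list_encode (map int_encode (map (\<lambda>m. m (x, y)) (monomials 4)) @ list_decode x), y))"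
    using computable2_code unfolding computable2_def by blast
  obtain r w Ms where
    wf: "\<And>x. wf_linrep k (map (\<lambda>m. m x) (monomials 4) @ replicate r 0, w, Ms)" and
    power: "\<And>x. has_power (linrep_seq k (map (\<lambda>m. m x) (monomials 4) @ replicate r 0, w, Ms)) \<alpha> \<longleftrightarrow>
      reval (Comp p [g]) [fst x, snd x] 0"
    using assms by (rule power_reduction) blast
  \<comment> \<open>The instance for the program that decides the negation of the answer to this very instance.\<close>
  define x where "x = list_encode (map int_encode (replicate r 0))"
  define y where "y = prod_encode (enc_intlist w, list_encode (map enc_mat Ms))"
  define R where "R = (map (\<lambda>m. m (x, y)) (monomials 4) @ replicate r 0, w, Ms)"
  \<comment> \<open>The fixed point: fed with its own two constants, \<open>g\<close> computes the
    code of the instance that has these constants as its parameters.\<close>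
  have "enc_linrep R = prod_encode
      (list_encode (map int_encode (map (\<lambda>m. m (x, y)) (monomials 4)) @ list_decode x), y)"
    by (simp add: R_def x_def enc_linrep_def enc_intlist_def flip: y_def)
      (simp add: y_def enc_intlist_def)
  with g have gR: "reval g [x, y] (enc_linrep R)" by metis
  have mem: "enc_linrep R \<in> power_problem k \<alpha> \<longleftrightarrow> has_power (linrep_seq k R) \<alpha>"
    using wf[of "(x, y)"] enc_linrep_inj unfolding power_problem_def R_def by blast
  have pow: "has_power (linrep_seq k R) \<alpha> \<longleftrightarrow> reval (Comp p [g]) [x, y] 0"
    using power[of "(x, y)"] by (simp add: R_def)
  \<comment> \<open>The answer is 0 exactly if the instance has no \<alpha>-power, whereas by
    construction it has one exactly if the answer is 0.\<close>
  have "reval (Comp p [g]) [x, y] (if enc_linrep R \<in> power_problem k \<alpha> then 1 else 0)"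
    using gR p by (rule reval_CompI1)
  then show False
    using mem pow reval_det by fastforce
qed

end
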